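(* Let $a>b>0$ and $\rho\in[0,\tfrac12]$ be fixed, let $K=\lceil \rho n\rceil$, and consider the binary asymmetric stochastic block model (defined in the context) with clusters of sizes $K$ and $n-K$. Let $\widehat Y_{\mathrm{SDP}}$ be the solution of $$\max_{Y}\ \langle A,Y\rangle\quad\text{s.t.}\quad Y\succeq 0,\ \ Y_{ii}=1\ (i\in[n]),\ \ \langle \mathbf J,Y\rangle=(2K-n)^2 .$$ If $\eta(\rho,a,b)>1$, then $$\min_{Y^*\in\mathcal Y_n}\mathbb P\{\widehat Y_{\mathrm{SDP}}=Y^*\}\ \ge\ 1-n^{-\Omega(1)}\quad\text{as } n\to\infty,$$ where $\widehat Y_{\mathrm{SDP}}=Y^*$ means that $Y^*$ is the unique optimal solution of the SDP.
   Context: Binary asymmetric SBM: there are $n$ vertices and a true labeling $\sigma^*\in\{\pm1\}^n$ with $(\sigma^* )^\top\mathbf 1=2K-n$ (so cluster $C_1^*=\{i:\sigma^*_i=1\}$ has $K$ vertices and $C_2^*$ has $n-K$). A random graph is generated with each pair $\{i,j\}$ independently connected with probability $p=a\log n/n$ if $\sigma^*_i=\sigma^*_j$ and $q=b\log n/n$ otherwise; $A$ is its (symmetric, zero-diagonal, $0/1$) adjacency matrix. $Y^*=\sigma^*(\sigma^* )^\top$ and $\mathcal Y_n=\{\sigma\sigma^\top:\sigma\in\{\pm1\}^n,\ \sigma^\top\mathbf 1=2K-n\}$. $\mathbf J$ is the all-ones matrix, $\mathbf 1$ the all-ones vector. Define $\bar\rho=1-\rho$, $\tau=\frac{a-b}{\log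 a-\log b}$, $\gamma=\sqrt{(\bar\rho-\rho)^2\tau^2+4\rho\bar\rho ab}$, and for $\rho\in(0,1)$ $$\eta(\rho,a,b)=\frac{a+b}{2}-\gamma+\frac{(\bar\rho-\rho)\tau}{2}\log\frac{\rho(\gamma+(\bar\rho-\rho)\tau)}{\bar\rho(\gamma-(\bar\rho-\rho)\tau)},$$ with $\eta(0,a,b)=\lim_{\rho\to0}\eta(\rho,a,b)=\frac{a+b}{2}-\tau\log\frac{e\sqrt{ab}}{\tau}$. Logarithms are natural. *)

theory Defs
  imports Complex_Main
begin

definition sbm_tau :: "real \<Rightarrow> real \<Rightarrow> real" where
  "sbm_tau a b = (a - b) / (ln a - ln b)"

definition sbm_gamma :: "real \<Rightarrow> real \<Rightarrow> real \<Rightarrow> real" where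
  "sbm_gamma \<rho> a b = sqrt (((1 - \<rho>) - \<rho>)^2 * (sbm_tau a b)^2 + 4 * \<rho> * (1 - \<rho>) * a * b)"

definition eta :: "real \<Rightarrow> real \<Rightarrow> real \<Rightarrow> real" where
  "eta \<rho> a b =
    (if \<rho> = 0 then (a + b) / 2 - sbm_tau a b * ln (exp 1 * sqrt (a * b) / sbm_tau a b)
     else (let \<tau> = sbm_tau a b; \<gamma> = sbm_gamma \<rho> a b; d = (1 - \<rho>) - \<rho> in
       (a + b) / 2 - \<gamma> + d * \<tau> / 2 *
         ln ((\<rho> * (\<gamma> + d * \<tau>)) / ((1 - \<rho>) * (\<gamma> - d * \<tau>)))))"

definition labelings :: "nat \<Rightarrow> nat \<Rightarrow> (nat \<Rightarrow> int) set" where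
  "labelings n K = {\<sigma>. (\<forall>i<n. \<sigma> i = 1 \<or> \<sigma> i = -1) \<and> (\<forall>i\<ge>n. \<sigma> i = 0)
                        \<and> (\<Sum>i<n. \<sigma> i) = 2 * int K - int n}"

definition Ystar :: "(nat \<Rightarrow> int) \<Rightarrow> nat \<Rightarrow> nat \<Rightarrow> real" where
  "Ystar \<sigma> i j = real_of_int (\<sigma> i * \<sigma> j)"

text \<open>Possible edges: unordered pairs, represented as (i,j) with i < j < n.\<close>
definition pairs :: "nat \<Rightarrow> (nat \<times> nat) set" where
  "pairs n = {(i, j). i < j \<and> j < n}"

definition adj :: "(nat \<times> nat) set \<Rightarrow> nat \<Rightarrow> nat \<Rightarrow> real" where
  "adj E i j = (if (min i j, max i j) \<in> E \<and> i \<noteq> j then 1 else 0)"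

definition edge_prob :: "nat \<Rightarrow> real \<Rightarrow> real \<Rightarrow> (nat \<Rightarrow> int) \<Rightarrow> nat \<Rightarrow> nat \<Rightarrow> real" where
  "edge_prob n a b \<sigma> i j =
     (if \<sigma> i = \<sigma> j then a * ln (real n) / real n else b * ln (real n) / real n)"

definition sbm_weight :: "nat \<Rightarrow> real \<Rightarrow> real \<Rightarrow> (nat \<Rightarrow> int) \<Rightarrow> (nat \<times> nat) set \<Rightarrow> real" where
  "sbm_weight n a b \<sigma> E =
     (\<Prod>(i, j)\<in>pairs n. if (i, j) \<in> E then edge_prob n a b \<sigma> i j else 1 - edge_prob n a b \<sigma> i j)"

definition sbm_prob ::
  "nat \<Rightarrow> real \<Rightarrow> real \<Rightarrow> (nat \<Rightarrow> int) \<Rightarrow> ((nat \<Rightarrow> nat \<Rightarrow> real) \<Rightarrow> bool) \<Rightarrow> real" where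
  "sbm_prob n a b \<sigma> P = (\<Sum>E\<in>{E. E \<subseteq> pairs n \<and> P (adj E)}. sbm_weight n a b \<sigma> E)"

definition psd :: "nat \<Rightarrow> (nat \<Rightarrow> nat \<Rightarrow> real) \<Rightarrow> bool" where
  "psd n Y \<longleftrightarrow> (\<forall>i<n. \<forall>j<n. Y i j = Y j i) \<and>
                (\<forall>x :: nat \<Rightarrow> real. (\<Sum>i<n. \<Sum>j<n. x i * Y i j * x j) \<ge> 0)"

definition inner_mat :: "nat \<Rightarrow> (nat \<Rightarrow> nat \<Rightarrow> real) \<Rightarrow> (nat \<Rightarrow> nat \<Rightarrow> real) \<Rightarrow> real" where
  "inner_mat n A Y = (\<Sum>i<n. \<Sum>j<n. A i j * Y i j)"

definition sdp_feasible :: "nat \<Rightarrow> nat \<Rightarrow> (nat \<Rightarrow> nat \<Rightarrow> real) \<Rightarrow> bool" where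
  "sdp_feasible n K Y \<longleftrightarrow> psd n Y \<and> (\<forall>i<n. Y i i = 1) \<and>
      inner_mat n (\<lambda>_ _. 1) Y = (2 * real K - real n)^2"

definition sdp_unique_opt ::
  "nat \<Rightarrow> nat \<Rightarrow> (nat \<Rightarrow> nat \<Rightarrow> real) \<Rightarrow> (nat \<Rightarrow> nat \<Rightarrow> real) \<Rightarrow> bool" where
  "sdp_unique_opt n K A Y0 \<longleftrightarrow> sdp_feasible n K Y0 \<and>
      (\<forall>Y. sdp_feasible n K Y \<and> (\<exists>i<n. \<exists>j<n. Y i j \<noteq> Y0 i j) \<longrightarrow>
            inner_mat n A Y < inner_mat n A Y0)"

end

theory Submission
  imports Defs "HOL-Real_Asymp.Real_Asymp"
begin

text \<open>
  Let \<open>L = ln n\<close> and \<open>lam = \<tau> L / n\<close>. The matrix \<open>S = D - A + lam J\<close>, where the diagonal matrix \<open>D\<close> is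
  chosen such that \<open>S \<sigma> = 0\<close>, is a dual certificate: if \<open>S\<close> is positive definite on the orthogonal
  complement of \<open>\<sigma>\<close>, then \<open>Ystar \<sigma>\<close> is the unique optimum. The proof of definiteness has two inputs.

  First, every diagonal entry of \<open>D\<close> is at least \<open>\<epsilon> L\<close>: by Chernoff's bound a fixed entry fails with
  probability \<open>n powr - (eta - o(1))\<close>, and \<open>eta > 1\<close> pays for the union bound over the vertices.

  Second, the deviation \<open>M\<close> of \<open>A\<close> from its mean has operator norm at most a small multiple of \<open>L\<close>.
  This follows, as in the converse expander mixing lemma of Bilu and Linial, from degrees of order
  \<open>L\<close> and from the discrepancy bound \<open>\<bar>M(S, T)\<bar> \<le> \<delta> L sqrt (card S * card T)\<close> for all vertex sets.

  For a vector \<open>u + w\<close> orthogonal to \<open>\<sigma>\<close>, with \<open>u\<close> constant on the clusters and \<open>w\<close> of sum zero on each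
  cluster, the mean of \<open>S\<close> contributes exactly \<open>(\<tau> - b) L\<close> times the squared norm of \<open>u\<close>, the diagonal
  contributes at least \<open>\<epsilon> L\<close> times that of \<open>w\<close>, and the cross terms involve \<open>D\<close> only through \<open>M \<sigma>\<close>,
  so they are controlled by the operator norm of \<open>M\<close> as well. If \<open>\<rho> = 0\<close>, then \<open>Ystar \<sigma>\<close> is the only
  feasible point.
\<close>

section \<open>Dual certificates\<close>

lemma psd_two_point:
  assumes "psd n Y" "i < n" "j < n"
  shows "0 \<le> s\<^sup>2 * Y i i + 2 * s * t * Y i j + t\<^sup>2 * Y j j"
proof -
  \<comment> \<open>Adding the two indicators also covers \<open>i = j\<close>, an instance that
    \<open>psd_gram\<close> uses for the sign of its pivot.\<close>
  define x where "x = (\<lambda>k. (if k = i then s else 0) + (if k = j then t else 0))"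
  have sum_x: "(\<Sum>k<n. x k * h k) = s * h i + t * h j" for h
    using assms(2,3) by (simp add: x_def distrib_right sum.distrib if_distrib[of "\<lambda>u. u * _"] cong: if_cong)
  have "(\<Sum>k<n. \<Sum>l<n. x k * Y k l * x l) = (\<Sum>k<n. x k * (\<Sum>l<n. x l * Y k l))"
    by (simp add: sum_distrib_left mult_ac)
  also have "\<dots> = s * (s * Y i i + t * Y i j) + t * (s * Y j i + t * Y j j)"
    by (simp only: sum_x)
  also have "Y j i = Y i j"
    using assms by (auto simp: psd_def)
  finally have "(\<Sum>k<n. \<Sum>l<n. x k * Y k l * x l) = s\<^sup>2 * Y i i + 2 * s * t * Y i j + t\<^sup>2 * Y j j"
    by (simp add: power2_eq_square algebra_simps)
  moreover have "0 \<le> (\<Sum>k<n. \<Sum>l<n. x k * Y k l * x l)"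
    using assms(1) unfolding psd_def by blast
  ultimately show ?thesis by simp
qed

lemma psd_diag_zero:
  assumes "psd n Y" "i < n" "j < n" "Y j j = 0"
  shows "Y i j = 0"
proof (rule ccontr)
  assume nz: "Y i j \<noteq> 0"
  \<comment> \<open>With \<open>Y j j = 0\<close> the form is affine in its second coefficient,
    which is chosen here to give the value -1.\<close>
  have "0 \<le> 1\<^sup>2 * Y i i + 2 * 1 * (- (Y i i + 1) / (2 * Y i j)) * Y i j + (- (Y i i + 1) / (2 * Y i j))\<^sup>2 * Y j j"
    by (rule psd_two_point[OF assms(1-3)])
  also have "\<dots> = -1"
    using nz assms(4) by (simp add: field_simps)
  finally show False by simp
qed

text \<open>This is Cholesky elimination. The Schur complement \<open>Z\<close> of the last index
  stays positive semidefinite because its form is the form of \<open>Y\<close> at the optimal last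
  coordinate \<open>t\<close>, and the eliminated column becomes a new Gram row. For pivot
  \<open>d = 0\<close> the last column vanishes by \<open>psd_diag_zero\<close>, in agreement with
  \<open>x / 0 = 0\<close>.\<close>

lemma psd_gram:
  "psd n Y \<Longrightarrow> \<exists>v::nat \<Rightarrow> nat \<Rightarrow> real. \<forall>i<n. \<forall>j<n. Y i j = (\<Sum>k<n. v k i * v k j)"
proof (induction n arbitrary: Y)
  case 0
  then show ?case by simp
next
  case (Suc n)
  define d where "d = Y n n"
  have sym: "Y i j = Y j i" if "i < Suc n" "j < Suc n" for i j
    using Suc.prems that by (auto simp: psd_def)
  have pos: "0 \<le> (\<Sum>i<Suc n. \<Sum>j<Suc n. x i * Y i j * x j)" for x
    using Suc.prems by (auto simp: psd_def)
  have "d \<ge> 0"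
    using psd_two_point[OF Suc.prems, of n n 1 0] by (simp add: d_def)
  define Z where "Z = (\<lambda>i j. Y i j - Y i n * Y j n / d)"
  have "psd n Z"
    unfolding psd_def
  proof (intro conjI allI impI)
    fix i j assume "i < n" "j < n"
    then show "Z i j = Z j i" using sym[of i j] by (simp add: Z_def)
  next
    fix x :: "nat \<Rightarrow> real"
    define s where "s = (\<Sum>i<n. x i * Y i n)"
    define t where "t = - s / d"
    define x' where "x' = x(n := t)"
    have s2: "(\<Sum>j<n. Y n j * x j) = s"
      unfolding s_def by (intro sum.cong refl) (use sym in auto)
    have "(\<Sum>i<Suc n. \<Sum>j<Suc n. x' i * Y i j * x' j)
        = (\<Sum>i<n. \<Sum>j<n. x i * Y i j * x j) + (\<Sum>i<n. x i * Y i n * t)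
          + ((\<Sum>j<n. t * Y n j * x j) + t * d * t)"
      by (simp add: x'_def d_def sum.distrib)
    also have "(\<Sum>i<n. x i * Y i n * t) = s * t"
      by (simp add: s_def sum_distrib_right)
    also have "(\<Sum>j<n. t * Y n j * x j) = t * s"
      by (simp add: s2[symmetric] sum_distrib_left mult_ac)
    also have "(\<Sum>i<n. \<Sum>j<n. x i * Y i j * x j) + s * t + (t * s + t * d * t)
        = (\<Sum>i<n. \<Sum>j<n. x i * Y i j * x j) - s * s / d"
      by (simp add: t_def)
    also have "s * s / d = (\<Sum>i<n. \<Sum>j<n. x i * (Y i n * Y j n / d) * x j)"
      unfolding s_def by (simp add: sum_product sum_divide_distrib mult_ac)
    also have "(\<Sum>i<n. \<Sum>j<n. x i * Y i j * x j) - (\<Sum>i<n. \<Sum>j<n. x i * (Y i n * Y j n / d) * x j)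
        = (\<Sum>i<n. \<Sum>j<n. x i * Z i j * x j)"
      by (simp add: Z_def sum_subtractf[symmetric] algebra_simps)
    finally show "0 \<le> (\<Sum>i<n. \<Sum>j<n. x i * Z i j * x j)"
      using pos[of x'] by simp
  qed
  from Suc.IH[OF this] obtain v where v: "\<And>i j. i < n \<Longrightarrow> j < n \<Longrightarrow> Z i j = (\<Sum>k<n. v k i * v k j)"
    by blast
  define v' where "v' = (\<lambda>k i. if k = n then Y i n / sqrt d else if i = n then 0 else v k i)"
  have vn: "v' n i * v' n j = Y i n * Y j n / d" for i j
    using \<open>d \<ge> 0\<close> by (simp add: v'_def)
  have last_col: "Y i n = Y i n * Y n n / d" if "i < Suc n" for i
    using psd_diag_zero[OF Suc.prems that, of n] by (cases "d = 0") (auto simp: d_def)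
  have "Y i j = (\<Sum>k<Suc n. v' k i * v' k j)" if "i < Suc n" "j < Suc n" for i j
  proof (cases "i = n \<or> j = n")
    case True
    then have "(\<Sum>k<n. v' k i * v' k j) = 0"
      by (intro sum.neutral) (auto simp: v'_def)
    moreover have "Y i j = Y i n * Y j n / d"
      using True last_col[OF that(1)] last_col[OF that(2)] sym[OF that] by (auto simp: mult_ac)
    ultimately show ?thesis by (simp add: vn)
  next
    case False
    then have "i < n" "j < n" using that by auto
    moreover have "(\<Sum>k<n. v' k i * v' k j) = (\<Sum>k<n. v k i * v k j)"
      using False by (intro sum.cong) (auto simp: v'_def)
    ultimately show ?thesis using v[of i j] by (simp add: vn Z_def)
  qed
  then show ?case by blast
qed

section \<open>Optimality of the planted matrix\<close>

lemma labelings_sum: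
  assumes "\<sigma> \<in> labelings n K"
  shows "(\<Sum>i<n. real_of_int (\<sigma> i)) = 2 * real K - real n"
proof -
  have "(\<Sum>i<n. real_of_int (\<sigma> i)) = real_of_int (\<Sum>i<n. \<sigma> i)" by simp
  also have "\<dots> = 2 * real K - real n" using assms by (simp add: labelings_def)
  finally show ?thesis .
qed

lemma labelings_square:
  assumes "\<sigma> \<in> labelings n K" "i < n"
  shows "real_of_int (\<sigma> i) * real_of_int (\<sigma> i) = 1"
proof -
  have "\<sigma> i = 1 \<or> \<sigma> i = -1" using assms by (simp add: labelings_def)
  then show ?thesis by auto
qed

lemma Ystar_feasible:
  assumes "\<sigma> \<in> labelings n K"
  shows "sdp_feasible n K (Ystar \<sigma>)"
proof -
  note lin = labelings_sum[OF assms]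
  have "(\<Sum>i<n. \<Sum>j<n. x i * Ystar \<sigma> i j * x j) = (\<Sum>i<n. x i * \<sigma> i)\<^sup>2" for x :: "nat \<Rightarrow> real"
    by (simp add: Ystar_def power2_eq_square sum_product mult_ac)
  moreover have "\<sigma> i * \<sigma> i = 1" if "i < n" for i
    using assms that by (auto simp: labelings_def)
  moreover have "inner_mat n (\<lambda>_ _. 1) (Ystar \<sigma>) = (2 * real K - real n)\<^sup>2"
    by (simp add: inner_mat_def Ystar_def power2_eq_square lin[symmetric] sum_product)
  ultimately show ?thesis
    by (auto simp: sdp_feasible_def psd_def Ystar_def mult.commute)
qed

text \<open>Applied with \<open>s\<close> the labeling: every Gram row can be replaced by its
  component orthogonal to the labeling, where the form is assumed positive.\<close>

lemma quadratic_form_shift_kernel: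
  fixes S :: "nat \<Rightarrow> nat \<Rightarrow> real"
  assumes sym: "\<And>i j. i < n \<Longrightarrow> j < n \<Longrightarrow> S i j = S j i"
    and ker: "\<And>i. i < n \<Longrightarrow> (\<Sum>j<n. S i j * s j) = 0"
  shows "(\<Sum>i<n. \<Sum>j<n. (x i + c * s i) * S i j * (x j + c * s j)) = (\<Sum>i<n. \<Sum>j<n. x i * S i j * x j)"
proof -
  have row: "(\<Sum>j<n. S i j * (x j + c * s j)) = (\<Sum>j<n. S i j * x j)" if "i < n" for i
  proof -
    have "(\<Sum>j<n. S i j * (x j + c * s j)) = (\<Sum>j<n. S i j * x j) + c * (\<Sum>j<n. S i j * s j)"
      by (simp add: sum_distrib_left sum.distrib algebra_simps)
    then show ?thesis using ker[OF that] by simp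
  qed
  have "(\<Sum>i<n. \<Sum>j<n. (x i + c * s i) * S i j * (x j + c * s j))
      = (\<Sum>i<n. (x i + c * s i) * (\<Sum>j<n. S i j * (x j + c * s j)))"
    by (simp add: sum_distrib_left mult_ac)
  also have "\<dots> = (\<Sum>i<n. (x i + c * s i) * (\<Sum>j<n. S i j * x j))"
    by (intro sum.cong refl) (simp add: row)
  also have "\<dots> = (\<Sum>i<n. x i * (\<Sum>j<n. S i j * x j)) + c * (\<Sum>i<n. s i * (\<Sum>j<n. S i j * x j))"
    by (simp add: sum_distrib_left sum.distrib algebra_simps)
  also have "(\<Sum>i<n. s i * (\<Sum>j<n. S i j * x j)) = (\<Sum>i<n. \<Sum>j<n. x j * (S i j * s i))"
    by (simp add: sum_distrib_left mult_ac)
  also have "\<dots> = (\<Sum>j<n. \<Sum>i<n. x j * (S i j * s i))"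
    by (rule sum.swap)
  also have "\<dots> = (\<Sum>j<n. x j * (\<Sum>i<n. S j i * s i))"
    by (simp only: sum_distrib_left[symmetric], intro sum.cong refl arg_cong2[where f="(*)"]) (auto simp: sym)
  also have "\<dots> = 0"
    by (intro sum.neutral) (auto simp: ker)
  finally show ?thesis by (simp add: sum_distrib_left mult_ac)
qed

text \<open>Feasibility fixes the diagonal and the total sum of \<open>Y\<close>, so the objective
  is a constant minus the inner product of \<open>S\<close> and \<open>Y\<close>. Written through
  Gram rows, that inner product is a sum of values of the form of \<open>S\<close>, hence
  nonnegative, and it vanishes at the planted matrix. If it vanishes at \<open>Y\<close>, every Gram
  row is a multiple of the labeling, and the unit diagonal then forces \<open>Y\<close> to be the
  planted matrix.\<close>

lemma sdp_dual_certificate: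
  fixes \<sigma> :: "nat \<Rightarrow> int" and A :: "nat \<Rightarrow> nat \<Rightarrow> real" and d :: "nat \<Rightarrow> real" and lam :: real
    and S :: "nat \<Rightarrow> nat \<Rightarrow> real"
  defines "S \<equiv> \<lambda>i j. (if i = j then d i else 0) - A i j + lam"
  assumes lab: "\<sigma> \<in> labelings n K"
    and symA: "\<And>i j. i < n \<Longrightarrow> j < n \<Longrightarrow> A i j = A j i"
    and ker: "\<And>i. i < n \<Longrightarrow> (\<Sum>j<n. S i j * \<sigma> j) = 0"
    and pos: "\<And>(x::nat \<Rightarrow> real) i. (\<Sum>i<n. x i * \<sigma> i) = 0 \<Longrightarrow> i < n \<Longrightarrow> x i \<noteq> 0 \<Longrightarrow> 0 < (\<Sum>i<n. \<Sum>j<n. x i * S i j * x j)"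
  shows "sdp_unique_opt n K A (Ystar \<sigma>)"
proof -
  define s where "s = (\<lambda>i. real_of_int (\<sigma> i))"
  have kers: "(\<Sum>j<n. S i j * s j) = 0" if "i < n" for i
    using ker[OF that] by (simp add: s_def)
  have s2: "s i * s i = 1" if "i < n" for i
    using labelings_square[OF lab that] by (simp add: s_def)
  have symS: "S i j = S j i" if "i < n" "j < n" for i j
    using symA[OF that] by (simp add: S_def)
  note shift = quadratic_form_shift_kernel[of n S s, OF symS kers]
  have pos0: "0 \<le> (\<Sum>i<n. \<Sum>j<n. x i * S i j * x j)" if "(\<Sum>i<n. x i * s i) = 0" for x
  proof (cases "\<exists>i<n. x i \<noteq> 0")
    case True
    then show ?thesis using pos[of x] that by (force simp: s_def)
  next
    case False
    then have "(\<Sum>i<n. \<Sum>j<n. x i * S i j * x j) = 0"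
      by (intro sum.neutral ballI) auto
    then show ?thesis by simp
  qed
  have obj: "inner_mat n A Y = (\<Sum>i<n. d i) + lam * (2 * real K - real n)\<^sup>2 - inner_mat n S Y"
    if "sdp_feasible n K Y" for Y
  proof -
    have "inner_mat n S Y = (\<Sum>i<n. \<Sum>j<n. (if i = j then d i * Y i j else 0) - A i j * Y i j + lam * Y i j)"
      unfolding inner_mat_def S_def by (intro sum.cong refl) (auto simp: algebra_simps)
    also have "\<dots> = (\<Sum>i<n. d i * Y i i) - inner_mat n A Y + lam * inner_mat n (\<lambda>_ _. 1) Y"
      by (simp add: sum.distrib sum_subtractf inner_mat_def sum_distrib_left)
    also have "(\<Sum>i<n. d i * Y i i) = (\<Sum>i<n. d i)"
      using that by (intro sum.cong) (auto simp: sdp_feasible_def)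
    finally show ?thesis using that by (simp add: sdp_feasible_def)
  qed
  have feas: "sdp_feasible n K (Ystar \<sigma>)" by (rule Ystar_feasible[OF lab])
  have "inner_mat n S (Ystar \<sigma>) = (\<Sum>i<n. \<Sum>j<n. (0 + 1 * s i) * S i j * (0 + 1 * s j))"
    by (simp add: inner_mat_def Ystar_def s_def mult_ac)
  then have star0: "inner_mat n S (Ystar \<sigma>) = 0"
    using shift[of "\<lambda>_. 0" 1] by simp
  have "inner_mat n S Y > 0"
    if fY: "sdp_feasible n K Y" and ne: "\<exists>i<n. \<exists>j<n. Y i j \<noteq> Ystar \<sigma> i j" for Y
  proof (rule ccontr)
    assume neg: "\<not> inner_mat n S Y > 0"
    obtain v where v: "\<And>i j. i < n \<Longrightarrow> j < n \<Longrightarrow> Y i j = (\<Sum>k<n. v k i * v k j)"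
      using psd_gram[of n Y] fY unfolding sdp_feasible_def by blast
    \<comment> \<open>Coefficient of the projection onto \<open>s\<close>, whose squared norm is
      \<open>n\<close>.\<close>
    define c where "c = (\<lambda>k. (\<Sum>i<n. v k i * s i) / real n)"
    define x where "x = (\<lambda>k i. v k i - c k * s i)"
    have orth: "(\<Sum>i<n. x k i * s i) = 0" for k
    proof -
      have "(\<Sum>i<n. x k i * s i) = (\<Sum>i<n. v k i * s i) - (\<Sum>i<n. c k * (s i * s i))"
        by (simp add: x_def algebra_simps sum_subtractf)
      also have "(\<Sum>i<n. c k * (s i * s i)) = (\<Sum>i<n. c k)"
        by (intro sum.cong refl) (simp add: s2)
      finally show ?thesis by (cases "n = 0") (simp_all add: c_def)
    qed
    define q where "q = (\<lambda>k. \<Sum>i<n. \<Sum>j<n. x k i * S i j * x k j)"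
    have q: "(\<Sum>i<n. \<Sum>j<n. v k i * S i j * v k j) = q k" for k
      using shift[of "x k" "c k"] by (simp add: x_def q_def)
    have "inner_mat n S Y = (\<Sum>i<n. \<Sum>j<n. \<Sum>k<n. v k i * S i j * v k j)"
      unfolding inner_mat_def
      by (intro sum.cong refl) (simp add: v sum_distrib_left mult_ac)
    also have "\<dots> = (\<Sum>i<n. \<Sum>k<n. \<Sum>j<n. v k i * S i j * v k j)"
      by (intro sum.cong refl sum.swap)
    also have "\<dots> = (\<Sum>k<n. \<Sum>i<n. \<Sum>j<n. v k i * S i j * v k j)"
      by (rule sum.swap)
    also have "\<dots> = (\<Sum>k<n. q k)" by (simp add: q)
    finally have sumq: "(\<Sum>k<n. q k) \<le> 0" using neg by simp
    have q0: "q k \<ge> 0" for k unfolding q_def using pos0[OF orth] .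
    have "q k = 0" if "k < n" for k
    proof -
      have "(\<Sum>k<n. q k) = 0" using sumq sum_nonneg[of "{..<n}" q] q0 by simp
      then show ?thesis using sum_nonneg_eq_0_iff[of "{..<n}" q] q0 that by simp
    qed
    then have x0: "x k i = 0" if "k < n" "i < n" for k i
      using pos[of "x k" i] orth[of k] that by (auto simp: q_def s_def)
    have Yc: "Y i j = (\<Sum>k<n. c k * c k) * (s i * s j)" if "i < n" "j < n" for i j
    proof -
      have "Y i j = (\<Sum>k<n. (c k * s i) * (c k * s j))"
        unfolding v[OF that] using x0 that by (intro sum.cong refl) (auto simp: x_def)
      also have "\<dots> = (\<Sum>k<n. c k * c k) * (s i * s j)"
        unfolding sum_distrib_right by (intro sum.cong refl) (simp only: mult_ac)
      finally show ?thesis .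
    qed
    obtain i where "i < n" using ne by blast
    then have "(\<Sum>k<n. c k * c k) = 1"
      using Yc[of i i] s2[of i] fY by (simp add: sdp_feasible_def)
    then show False using Yc ne by (auto simp: Ystar_def s_def)
  qed
  then have "inner_mat n A Y < inner_mat n A (Ystar \<sigma>)"
    if "sdp_feasible n K Y" "\<exists>i<n. \<exists>j<n. Y i j \<noteq> Ystar \<sigma> i j" for Y
    using obj[OF feas] obj[OF that(1)] star0 that by fastforce
  then show ?thesis
    unfolding sdp_unique_opt_def using feas by blast
qed

text \<open>The test vector with entries 1 and -1 shows that entries of a feasible \<open>Y\<close>
  are at most 1, while for \<open>K = 0\<close> their sum must be the square of \<open>n\<close>.
  Hence all entries are 1, whatever \<open>A\<close> is. This settles \<rho> = 0, where no positive
  fraction \<kappa> of the vertices lies in the first cluster.\<close>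

lemma sdp_trivial_cluster:
  assumes lab: "\<sigma> \<in> labelings n 0"
  shows "sdp_unique_opt n 0 A (Ystar \<sigma>)"
proof -
  have all: "\<sigma> i = -1" if "i < n" for i
  proof -
    have "(\<Sum>i<n. \<sigma> i + 1) = 0"
      using lab by (simp add: labelings_def sum.distrib)
    moreover have "\<And>i. i < n \<Longrightarrow> \<sigma> i + 1 \<ge> 0" using lab by (force simp: labelings_def)
    ultimately have "\<sigma> i + 1 = 0"
      using that sum_nonneg_eq_0_iff[of "{..<n}" "\<lambda>i. \<sigma> i + 1"] by auto
    then show ?thesis by simp
  qed
  have "Y i j = Ystar \<sigma> i j" if fY: "sdp_feasible n 0 Y" and ij: "i < n" "j < n" for Y i j
  proof -
    have psd: "psd n Y" using fY by (simp add: sdp_feasible_def)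
    have le: "1 - Y k l \<ge> 0" if "k < n" "l < n" for k l
      using psd_two_point[OF psd that, of 1 "-1"] fY that by (simp add: sdp_feasible_def)
    have "(\<Sum>k<n. \<Sum>l<n. 1 - Y k l) = 0"
      using fY by (simp add: sdp_feasible_def inner_mat_def sum_subtractf power2_eq_square)
    moreover have "0 \<le> (\<Sum>l<n. 1 - Y k l)" if "k < n" for k
      using le that by (intro sum_nonneg) auto
    ultimately have "(\<Sum>l<n. 1 - Y i l) = 0"
      using ij sum_nonneg_eq_0_iff[of "{..<n}" "\<lambda>k. \<Sum>l<n. 1 - Y k l"] by auto
    then have "1 - Y i j = 0"
      using ij le sum_nonneg_eq_0_iff[of "{..<n}" "\<lambda>l. 1 - Y i l"] by auto
    then show ?thesis using all ij by (simp add: Ystar_def)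
  qed
  then show ?thesis
    unfolding sdp_unique_opt_def using Ystar_feasible[OF lab] by blast
qed

section \<open>From discrepancy to the operator norm\<close>

lemma binary_digits_sum:
  "m < 2 ^ N \<Longrightarrow> (\<Sum>k<N. (m div 2 ^ k mod 2) * 2 ^ k) = (m::nat)"
proof (induction N arbitrary: m)
  case (Suc N)
  have "m div 2 < 2 ^ N" using Suc.prems by auto
  have "(\<Sum>k<Suc N. (m div 2 ^ k mod 2) * 2 ^ k) = m mod 2 + 2 * (\<Sum>k<N. (m div 2 div 2 ^ k mod 2) * 2 ^ k)"
    unfolding sum.lessThan_Suc_shift by (simp add: sum_distrib_left div_mult2_eq mult_ac)
  also have "\<dots> = m" using Suc.IH[OF \<open>m div 2 < 2 ^ N\<close>] by simp
  finally show ?case .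
qed auto

lemma sum_squares_le_square_sum:
  fixes f :: "nat \<Rightarrow> real"
  assumes "\<And>k. f k \<ge> 0"
  shows "(\<Sum>k<N. (f k)\<^sup>2) \<le> (\<Sum>k<N. f k)\<^sup>2"
proof (induction N)
  case (Suc N)
  have "0 \<le> 2 * (\<Sum>k<N. f k) * f N" using assms by (simp add: sum_nonneg)
  then show ?case using Suc by (simp add: power2_sum mult_ac)
qed simp

text \<open>Digits rather than level sets are used because a vector of natural numbers is exactly
  the sum of \<open>2 ^ k\<close> times the indicators of its digit sets, so a bilinear form becomes
  a weighted sum of rectangle sums without rounding.\<close>

definition digit_set :: "nat \<Rightarrow> (nat \<Rightarrow> nat) \<Rightarrow> nat \<Rightarrow> nat set" where
  "digit_set n f k = {i. i < n \<and> f i div 2 ^ k mod 2 = 1}"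

lemma digit_set_subset: "digit_set n f k \<subseteq> {..<n}"
  by (auto simp: digit_set_def)

lemma digit_decomposition:
  assumes "i < n" "f i < 2 ^ N"
  shows "real (f i) = (\<Sum>k<N. 2 ^ k * of_bool (i \<in> digit_set n f k))"
proof -
  have "real (f i) = real (\<Sum>k<N. (f i div 2 ^ k mod 2) * 2 ^ k)"
    by (simp only: binary_digits_sum[OF assms(2)])
  also have "\<dots> = (\<Sum>k<N. real (f i div 2 ^ k mod 2) * 2 ^ k)" by simp
  also have "\<dots> = (\<Sum>k<N. 2 ^ k * of_bool (i \<in> digit_set n f k))"
    using assms(1) by (intro sum.cong refl) (auto simp: digit_set_def)
  finally show ?thesis .
qed

text \<open>Squaring the digit expansion of an entry only adds nonnegative cross terms to the
  squares of its digits.\<close>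

lemma digit_energy:
  assumes "\<And>i. i < n \<Longrightarrow> f i < 2 ^ N"
  shows "(\<Sum>k<N. 4 ^ k * real (card (digit_set n f k))) \<le> (\<Sum>i<n. (real (f i))\<^sup>2)"
proof -
  have "(\<Sum>k<N. 4 ^ k * real (card (digit_set n f k))) = (\<Sum>k<N. \<Sum>i<n. (2 ^ k * of_bool (i \<in> digit_set n f k))\<^sup>2)"
  proof (intro sum.cong refl)
    fix k
    have "(\<Sum>i<n. (2 ^ k * of_bool (i \<in> digit_set n f k))\<^sup>2) = (\<Sum>i<n. 4 ^ k * (of_bool (i \<in> digit_set n f k) :: real))"
      by (intro sum.cong refl) (auto simp: power_mult_distrib power2_eq_square simp flip: power_mult_distrib)
    also have "\<dots> = 4 ^ k * real (card ({..<n} \<inter> digit_set n f k))"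
      by (simp add: sum_distrib_left[symmetric] Int_def)
    also have "{..<n} \<inter> digit_set n f k = digit_set n f k" using digit_set_subset by blast
    finally show "4 ^ k * real (card (digit_set n f k)) = (\<Sum>i<n. (2 ^ k * of_bool (i \<in> digit_set n f k))\<^sup>2)" ..
  qed
  also have "\<dots> = (\<Sum>i<n. \<Sum>k<N. (2 ^ k * of_bool (i \<in> digit_set n f k))\<^sup>2)"
    by (rule sum.swap)
  also have "\<dots> \<le> (\<Sum>i<n. (\<Sum>k<N. 2 ^ k * of_bool (i \<in> digit_set n f k))\<^sup>2)"
    by (intro sum_mono sum_squares_le_square_sum) simp
  also have "\<dots> = (\<Sum>i<n. (real (f i))\<^sup>2)"
    by (intro sum.cong refl arg_cong[where f = "\<lambda>u. u\<^sup>2"] digit_decomposition[symmetric] assms) auto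
  finally show ?thesis .
qed

text \<open>The share of the rectangle at binary scales \<open>2 ^ k\<close> and \<open>2 ^ m\<close> that is charged to the
  first vector: scales within a factor \<open>2 ^ r\<close> are handled by the discrepancy \<open>\<alpha>\<close>, all others by
  the row sum bound \<open>l\<close>, which then gains a geometric factor.\<close>

definition scale_weight :: "real \<Rightarrow> real \<Rightarrow> nat \<Rightarrow> nat \<Rightarrow> nat \<Rightarrow> real" where
  "scale_weight \<alpha> l r k m =
     (if k \<le> m + r \<and> m \<le> k + r then \<alpha> / 2 else 0) + (if m + r < k then l * 2 ^ m / 2 ^ k else 0)"

text \<open>At most \<open>2 * r + 1\<close> scales lie within \<open>r\<close> of \<open>k\<close>,
  each contributing \<alpha> / 2. The scales below \<open>k - r\<close> form a geometric series with
  sum at most \<open>l / 2 ^ r\<close>.\<close>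

lemma scale_weight_sum:
  assumes "\<alpha> \<ge> 0" "l \<ge> 0"
  shows "(\<Sum>m<N. scale_weight \<alpha> l r k m) \<le> \<alpha> * (2 * real r + 1) / 2 + l / 2 ^ r"
proof -
  have "(\<Sum>m<N. if k \<le> m + r \<and> m \<le> k + r then \<alpha> / 2 else 0) = (\<Sum>m\<in>{m\<in>{..<N}. k \<le> m + r \<and> m \<le> k + r}. \<alpha> / 2)"
    by (simp only: sum.inter_filter finite_lessThan)
  also have "\<dots> \<le> real (card {k - r..k + r}) * (\<alpha> / 2)"
    unfolding sum_constant using assms by (intro mult_right_mono of_nat_mono card_mono) auto
  also have "\<dots> \<le> (2 * real r + 1) * (\<alpha> / 2)"
    using assms by (intro mult_right_mono) auto
  finally have 1: "(\<Sum>m<N. if k \<le> m + r \<and> m \<le> k + r then \<alpha> / 2 else 0) \<le> (2 * real r + 1) * (\<alpha> / 2)" .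
  have "(\<Sum>m<N. if m + r < k then l * 2 ^ m / 2 ^ k else 0) = (\<Sum>m\<in>{m\<in>{..<N}. m + r < k}. l * 2 ^ m / 2 ^ k)"
    by (simp only: sum.inter_filter finite_lessThan)
  also have "\<dots> \<le> (\<Sum>m<k - r. l * 2 ^ m / 2 ^ k)"
    using assms by (intro sum_mono2) auto
  also have "\<dots> = l / 2 ^ k * (2 ^ (k - r) - 1)"
  proof -
    have "(\<Sum>m<k - r. l * 2 ^ m / 2 ^ k) = l / 2 ^ k * (\<Sum>m<k - r. (2::real) ^ m)"
      by (simp add: sum_distrib_left)
    also have "(\<Sum>m<k - r. (2::real) ^ m) = 2 ^ (k - r) - 1"
      by (simp add: geometric_sum)
    finally show ?thesis .
  qed
  also have "\<dots> \<le> l / 2 ^ r"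
  proof (cases "r \<le> k")
    case True
    then have "l / 2 ^ k * 2 ^ (k - r) = l / 2 ^ r" by (simp add: power_diff)
    moreover have "l / 2 ^ k \<ge> 0" using assms by simp
    ultimately show ?thesis by (simp add: right_diff_distrib)
  next
    case False
    then show ?thesis using assms by simp
  qed
  finally show ?thesis using 1 by (simp add: scale_weight_def sum.distrib mult_ac)
qed

section \<open>Norm bound from rectangle sums\<close>

lemma rect_sum_le_rows:
  fixes M :: "nat \<Rightarrow> nat \<Rightarrow> real"
  assumes row: "\<And>i. i < n \<Longrightarrow> (\<Sum>j<n. \<bar>M i j\<bar>) \<le> l"
    and "S \<subseteq> {..<n}" "T \<subseteq> {..<n}"
  shows "\<bar>\<Sum>i\<in>S. \<Sum>j\<in>T. M i j\<bar> \<le> l * real (card S)"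
proof -
  have fin: "finite S" "finite T" using assms by (auto intro: finite_subset)
  have "\<bar>\<Sum>i\<in>S. \<Sum>j\<in>T. M i j\<bar> \<le> (\<Sum>i\<in>S. \<Sum>j\<in>T. \<bar>M i j\<bar>)"
    by (intro order.trans[OF sum_abs] sum_mono) auto
  also have "\<dots> \<le> (\<Sum>i\<in>S. \<Sum>j<n. \<bar>M i j\<bar>)"
    using assms by (intro sum_mono sum_mono2) auto
  also have "\<dots> \<le> (\<Sum>i\<in>S. l)"
    using assms row by (intro sum_mono) auto
  finally show ?thesis by (simp add: mult_ac)
qed

lemma rect_sum_le_cols:
  fixes M :: "nat \<Rightarrow> nat \<Rightarrow> real"
  assumes col: "\<And>j. j < n \<Longrightarrow> (\<Sum>i<n. \<bar>M i j\<bar>) \<le> l"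
    and "S \<subseteq> {..<n}" "T \<subseteq> {..<n}"
  shows "\<bar>\<Sum>i\<in>S. \<Sum>j\<in>T. M i j\<bar> \<le> l * real (card T)"
proof -
  have "(\<Sum>i\<in>S. \<Sum>j\<in>T. M i j) = (\<Sum>j\<in>T. \<Sum>i\<in>S. M i j)" by (rule sum.swap)
  also have "\<bar>\<dots>\<bar> \<le> (\<Sum>j\<in>T. \<Sum>i\<in>S. \<bar>M i j\<bar>)"
    by (intro order.trans[OF sum_abs] sum_mono) auto
  also have "\<dots> \<le> (\<Sum>j\<in>T. \<Sum>i<n. \<bar>M i j\<bar>)"
    using assms by (intro sum_mono sum_mono2) auto
  also have "\<dots> \<le> (\<Sum>j\<in>T. l)"
    using assms col by (intro sum_mono) auto
  finally show ?thesis by (simp add: mult_ac)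
qed

context
  fixes n :: nat and M :: "nat \<Rightarrow> nat \<Rightarrow> real" and \<alpha> l :: real
  assumes \<alpha>: "\<alpha> \<ge> 0" and l: "l \<ge> 0"
    and disc: "\<And>S T. S \<subseteq> {..<n} \<Longrightarrow> T \<subseteq> {..<n} \<Longrightarrow> \<bar>\<Sum>i\<in>S. \<Sum>j\<in>T. M i j\<bar> \<le> \<alpha> * sqrt (real (card S) * real (card T))"
    and row: "\<And>i. i < n \<Longrightarrow> (\<Sum>j<n. \<bar>M i j\<bar>) \<le> l"
    and col: "\<And>j. j < n \<Longrightarrow> (\<Sum>i<n. \<bar>M i j\<bar>) \<le> l"
begin

text \<open>For comparable scales the discrepancy bound is split between the two sets by the
  inequality of arithmetic and geometric means. Otherwise the whole rectangle is charged to the set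
  at the larger scale through the row or column sums; since
  \<open>2 ^ k * 2 ^ m = 4 ^ k * (2 ^ m / 2 ^ k)\<close>, the gap between the scales becomes a
  gain.\<close>

lemma scaled_rect_sum_le:
  assumes S: "S \<subseteq> {..<n}" and T: "T \<subseteq> {..<n}"
  shows "2 ^ k * 2 ^ m * \<bar>\<Sum>i\<in>S. \<Sum>j\<in>T. M i j\<bar>
    \<le> scale_weight \<alpha> l r k m * (4 ^ k * real (card S)) + scale_weight \<alpha> l r m k * (4 ^ m * real (card T))"
    (is "?lhs \<le> ?rhs")
proof -
  have four: "(4::real) ^ j = 2 ^ j * 2 ^ j" for j
    by (simp flip: power_mult_distrib)
  consider "k \<le> m + r \<and> m \<le> k + r" | "m + r < k" | "k + r < m" by linarith
  then show ?thesis
  proof cases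
    case 1
    have "2 ^ k * 2 ^ m * sqrt (real (card S) * real (card T))
        = sqrt ((4 ^ k * real (card S)) * (4 ^ m * real (card T)))"
      by (simp add: four real_sqrt_mult)
    also have "\<dots> \<le> (4 ^ k * real (card S) + 4 ^ m * real (card T)) / 2"
      by (rule arith_geo_mean_sqrt) auto
    finally have am: "2 ^ k * 2 ^ m * sqrt (real (card S) * real (card T))
      \<le> (4 ^ k * real (card S) + 4 ^ m * real (card T)) / 2" .
    have "?lhs \<le> 2 ^ k * 2 ^ m * (\<alpha> * sqrt (real (card S) * real (card T)))"
      by (intro mult_left_mono disc S T) auto
    also have "\<dots> = \<alpha> * (2 ^ k * 2 ^ m * sqrt (real (card S) * real (card T)))" by simp
    also have "\<dots> \<le> \<alpha> * ((4 ^ k * real (card S) + 4 ^ m * real (card T)) / 2)"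
      by (intro mult_left_mono am \<alpha>)
    also have "\<dots> = ?rhs" using 1 by (simp add: scale_weight_def algebra_simps add_divide_distrib)
    finally show ?thesis .
  next
    case 2
    have "?lhs \<le> 2 ^ k * 2 ^ m * (l * real (card S))"
      by (intro mult_left_mono rect_sum_le_rows[OF row] S T) auto
    also have "\<dots> = ?rhs" using 2 by (simp add: scale_weight_def four)
    finally show ?thesis .
  next
    case 3
    have "?lhs \<le> 2 ^ k * 2 ^ m * (l * real (card T))"
      by (intro mult_left_mono rect_sum_le_cols[OF col] S T) auto
    also have "\<dots> = ?rhs" using 3 by (simp add: scale_weight_def four)
    finally show ?thesis .
  qed
qed

text \<open>The charges of all pairs of scales are added with \<open>scale_weight_sum\<close>, and
  \<open>digit_energy\<close> returns to the norms. The free parameter \<open>r\<close> trades the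
  discrepancy, paid on about \<open>2 * r + 1\<close> scales, against the row sums, damped by
  \<open>2 ^ r\<close>.\<close>

lemma bilinear_bound_nat:
  fixes f g :: "nat \<Rightarrow> nat"
  shows "\<bar>\<Sum>i<n. \<Sum>j<n. real (f i) * M i j * real (g j)\<bar>
    \<le> (\<alpha> * (2 * real r + 1) / 2 + l / 2 ^ r) * ((\<Sum>i<n. (real (f i))\<^sup>2) + (\<Sum>i<n. (real (g i))\<^sup>2))"
proof -
  \<comment> \<open>Any number of digits that accommodates all entries will do, since the final
    bound does not depend on it.\<close>
  define N where "N = Suc (\<Sum>i<n. f i + g i)"
  have le: "f i < 2 ^ N" "g i < 2 ^ N" if "i < n" for i
  proof -
    have "f i + g i \<le> (\<Sum>i<n. f i + g i)"
      using that by (intro member_le_sum) auto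
    moreover have "N < 2 ^ N" by simp
    ultimately show "f i < 2 ^ N" "g i < 2 ^ N" by (auto simp: N_def)
  qed
  define B where "B = \<alpha> * (2 * real r + 1) / 2 + l / 2 ^ r"
  have "B \<ge> 0" using \<alpha> l by (simp add: B_def)
  let ?S = "digit_set n f" and ?T = "digit_set n g"
  let ?X = "\<lambda>k. 4 ^ k * real (card (?S k))" and ?Y = "\<lambda>k. 4 ^ k * real (card (?T k))"
  let ?w = "scale_weight \<alpha> l r"
  have rect: "(\<Sum>i<n. \<Sum>j<n. of_bool (i \<in> ?S k) * M i j * of_bool (j \<in> ?T m)) = (\<Sum>i\<in>?S k. \<Sum>j\<in>?T m. M i j)" for k m
  proof -
    have "(\<Sum>i\<in>?S k. \<Sum>j\<in>?T m. M i j) = (\<Sum>i<n. of_bool (i \<in> ?S k) * (\<Sum>j\<in>?T m. M i j))"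
      using digit_set_subset[of n f k] by (intro sum.mono_neutral_cong_left) auto
    also have "\<dots> = (\<Sum>i<n. of_bool (i \<in> ?S k) * (\<Sum>j<n. M i j * of_bool (j \<in> ?T m)))"
      using digit_set_subset[of n g m]
      by (intro sum.cong refl arg_cong2[where f = "(*)"] sum.mono_neutral_cong_left) auto
    finally show ?thesis by (simp only: sum_distrib_left mult.assoc)
  qed
  have "(\<Sum>i<n. \<Sum>j<n. real (f i) * M i j * real (g j))
      = (\<Sum>i<n. \<Sum>j<n. \<Sum>k<N. \<Sum>m<N. 2 ^ k * 2 ^ m * (of_bool (i \<in> ?S k) * M i j * of_bool (j \<in> ?T m)))"
  proof (intro sum.cong refl)
    fix i j assume "i \<in> {..<n}" "j \<in> {..<n}"
    then have "i < n" "j < n" by auto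
    then have "real (f i) = (\<Sum>k<N. 2 ^ k * of_bool (i \<in> ?S k))" "real (g j) = (\<Sum>k<N. 2 ^ k * of_bool (j \<in> ?T k))"
      using le digit_decomposition by blast+
    then have "real (f i) * M i j * real (g j)
        = (\<Sum>k<N. 2 ^ k * of_bool (i \<in> ?S k)) * (\<Sum>k<N. 2 ^ k * of_bool (j \<in> ?T k)) * M i j"
      by (simp only: mult_ac)
    also have "\<dots> = (\<Sum>k<N. \<Sum>m<N. (2 ^ k * of_bool (i \<in> ?S k)) * (2 ^ m * of_bool (j \<in> ?T m)) * M i j)"
      unfolding sum_product by (simp only: sum_distrib_right)
    also have "\<dots> = (\<Sum>k<N. \<Sum>m<N. 2 ^ k * 2 ^ m * (of_bool (i \<in> ?S k) * M i j * of_bool (j \<in> ?T m)))"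
      by (intro sum.cong refl) (simp only: mult_ac)
    finally show "real (f i) * M i j * real (g j) = \<dots>" .
  qed
  also have "\<dots> = (\<Sum>i<n. \<Sum>k<N. \<Sum>j<n. \<Sum>m<N. 2 ^ k * 2 ^ m * (of_bool (i \<in> ?S k) * M i j * of_bool (j \<in> ?T m)))"
    by (intro sum.cong refl sum.swap)
  also have "\<dots> = (\<Sum>k<N. \<Sum>i<n. \<Sum>j<n. \<Sum>m<N. 2 ^ k * 2 ^ m * (of_bool (i \<in> ?S k) * M i j * of_bool (j \<in> ?T m)))"
    by (rule sum.swap)
  also have "\<dots> = (\<Sum>k<N. \<Sum>i<n. \<Sum>m<N. \<Sum>j<n. 2 ^ k * 2 ^ m * (of_bool (i \<in> ?S k) * M i j * of_bool (j \<in> ?T m)))"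
    by (intro sum.cong refl sum.swap)
  also have "\<dots> = (\<Sum>k<N. \<Sum>m<N. \<Sum>i<n. \<Sum>j<n. 2 ^ k * 2 ^ m * (of_bool (i \<in> ?S k) * M i j * of_bool (j \<in> ?T m)))"
    by (intro sum.cong refl sum.swap)
  also have "\<dots> = (\<Sum>k<N. \<Sum>m<N. 2 ^ k * 2 ^ m * (\<Sum>i\<in>?S k. \<Sum>j\<in>?T m. M i j))"
    by (simp only: sum_distrib_left[symmetric] rect)
  finally have expand: "(\<Sum>i<n. \<Sum>j<n. real (f i) * M i j * real (g j))
      = (\<Sum>k<N. \<Sum>m<N. 2 ^ k * 2 ^ m * (\<Sum>i\<in>?S k. \<Sum>j\<in>?T m. M i j))" .
  have "\<bar>\<Sum>i<n. \<Sum>j<n. real (f i) * M i j * real (g j)\<bar> \<le> (\<Sum>k<N. \<Sum>m<N. 2 ^ k * 2 ^ m * \<bar>\<Sum>i\<in>?S k. \<Sum>j\<in>?T m. M i j\<bar>)"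
    unfolding expand by (intro order.trans[OF sum_abs] sum_mono) (auto simp: abs_mult)
  also have "\<dots> \<le> (\<Sum>k<N. \<Sum>m<N. ?w k m * ?X k + ?w m k * ?Y m)"
    by (rule sum_mono, rule sum_mono, rule scaled_rect_sum_le[OF digit_set_subset digit_set_subset])
  also have "\<dots> = (\<Sum>k<N. \<Sum>m<N. ?w k m * ?X k) + (\<Sum>m<N. \<Sum>k<N. ?w m k * ?Y m)"
    by (simp only: sum.distrib) (rule arg_cong2[where f = "(+)"], rule refl, rule sum.swap)
  also have "\<dots> = (\<Sum>k<N. (\<Sum>m<N. ?w k m) * ?X k) + (\<Sum>m<N. (\<Sum>k<N. ?w m k) * ?Y m)"
    by (simp only: sum_distrib_right)
  also have "\<dots> \<le> (\<Sum>k<N. B * ?X k) + (\<Sum>m<N. B * ?Y m)"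
    unfolding B_def by (intro add_mono sum_mono mult_right_mono scale_weight_sum \<alpha> l) auto
  also have "\<dots> = B * ((\<Sum>k<N. ?X k) + (\<Sum>k<N. ?Y k))"
    by (simp only: sum_distrib_left distrib_left)
  also have "\<dots> \<le> B * ((\<Sum>i<n. (real (f i))\<^sup>2) + (\<Sum>i<n. (real (g i))\<^sup>2))"
    using \<open>B \<ge> 0\<close> by (intro mult_left_mono add_mono digit_energy le) auto
  finally show ?thesis unfolding B_def .
qed

text \<open>Entries are rounded down to multiples of \<open>1 / Suc N\<close>. Both sides are
  homogeneous of degree 2, so the integer case applies after scaling, and \<open>N\<close> tends to
  infinity.\<close>

lemma bilinear_bound_nonneg:
  fixes x y :: "nat \<Rightarrow> real"
  assumes "\<And>i. x i \<ge> 0" "\<And>i. y i \<ge> 0"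
  shows "\<bar>\<Sum>i<n. \<Sum>j<n. x i * M i j * y j\<bar>
    \<le> (\<alpha> * (2 * real r + 1) / 2 + l / 2 ^ r) * ((\<Sum>i<n. (x i)\<^sup>2) + (\<Sum>i<n. (y i)\<^sup>2))"
proof -
  define B where "B = \<alpha> * (2 * real r + 1) / 2 + l / 2 ^ r"
  define h where "h = (\<lambda>(z::real) N. real (nat \<lfloor>z * real (Suc N)\<rfloor>) / real (Suc N))"
  have h_lim: "(\<lambda>N. h z N) \<longlonglongrightarrow> z" if "z \<ge> 0" for z
  proof (rule tendsto_sandwich)
    have "z - 1 / real (Suc N) \<le> h z N" "h z N \<le> z" for N
    proof -
      have eq: "real (nat \<lfloor>z * real (Suc N)\<rfloor>) = real_of_int \<lfloor>z * real (Suc N)\<rfloor>"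
        using that by simp
      have "z - 1 / real (Suc N) = (z * real (Suc N) - 1) / real (Suc N)"
        by (simp add: field_simps del: of_nat_Suc)
      also have "\<dots> \<le> h z N"
        unfolding h_def eq using floor_correct[of "z * real (Suc N)"]
        by (intro divide_right_mono) linarith+
      finally show "z - 1 / real (Suc N) \<le> h z N" .
      have "h z N \<le> (z * real (Suc N)) / real (Suc N)"
        unfolding h_def eq by (intro divide_right_mono) linarith+
      then show "h z N \<le> z" by (simp del: of_nat_Suc)
    qed
    then show "\<forall>\<^sub>F N in sequentially. z - 1 / real (Suc N) \<le> h z N" "\<forall>\<^sub>F N in sequentially. h z N \<le> z"
      by auto
    show "(\<lambda>N. z - 1 / real (Suc N)) \<longlonglongrightarrow> z"
      using tendsto_diff[OF tendsto_const lim_1_over_n[THEN LIMSEQ_Suc], of z] by simp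
  qed simp
  have "\<bar>\<Sum>i<n. \<Sum>j<n. h (x i) N * M i j * h (y j) N\<bar> \<le> B * ((\<Sum>i<n. (h (x i) N)\<^sup>2) + (\<Sum>i<n. (h (y i) N)\<^sup>2))" for N
  proof -
    let ?s = "real (Suc N)"
    let ?f = "\<lambda>i. nat \<lfloor>x i * real (Suc N)\<rfloor>" and ?g = "\<lambda>i. nat \<lfloor>y i * real (Suc N)\<rfloor>"
    have "\<bar>\<Sum>i<n. \<Sum>j<n. h (x i) N * M i j * h (y j) N\<bar> = \<bar>(\<Sum>i<n. \<Sum>j<n. real (?f i) * M i j * real (?g j)) / ?s\<^sup>2\<bar>"
      by (simp add: h_def sum_divide_distrib power2_eq_square mult_ac del: of_nat_Suc)
    also have "\<dots> = \<bar>\<Sum>i<n. \<Sum>j<n. real (?f i) * M i j * real (?g j)\<bar> / ?s\<^sup>2"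
      by (simp del: of_nat_Suc)
    also have "\<dots> \<le> (B * ((\<Sum>i<n. (real (?f i))\<^sup>2) + (\<Sum>i<n. (real (?g i))\<^sup>2))) / ?s\<^sup>2"
      unfolding B_def by (intro divide_right_mono bilinear_bound_nat) simp
    also have "\<dots> = B * ((\<Sum>i<n. (real (?f i))\<^sup>2 / ?s\<^sup>2) + (\<Sum>i<n. (real (?g i))\<^sup>2 / ?s\<^sup>2))"
      by (simp only: sum_divide_distrib[symmetric] add_divide_distrib[symmetric] times_divide_eq_right)
    also have "\<dots> = B * ((\<Sum>i<n. (h (x i) N)\<^sup>2) + (\<Sum>i<n. (h (y i) N)\<^sup>2))"
      by (simp only: h_def power_divide)
    finally show ?thesis .
  qed
  moreover have "(\<lambda>N. \<bar>\<Sum>i<n. \<Sum>j<n. h (x i) N * M i j * h (y j) N\<bar>) \<longlonglongrightarrow> \<bar>\<Sum>i<n. \<Sum>j<n. x i * M i j * y j\<bar>"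
    by (intro tendsto_intros h_lim assms)
  moreover have "(\<lambda>N. B * ((\<Sum>i<n. (h (x i) N)\<^sup>2) + (\<Sum>i<n. (h (y i) N)\<^sup>2))) \<longlonglongrightarrow> B * ((\<Sum>i<n. (x i)\<^sup>2) + (\<Sum>i<n. (y i)\<^sup>2))"
    by (intro tendsto_intros h_lim assms)
  ultimately show ?thesis unfolding B_def[symmetric] by (intro LIMSEQ_le) auto
qed

text \<open>Splitting both vectors into positive and negative parts gives four forms. Each part
  occurs in two of them, whence the factor 2.\<close>

lemma bilinear_bound:
  fixes x y :: "nat \<Rightarrow> real"
  shows "\<bar>\<Sum>i<n. \<Sum>j<n. x i * M i j * y j\<bar>
    \<le> 2 * (\<alpha> * (2 * real r + 1) / 2 + l / 2 ^ r) * ((\<Sum>i<n. (x i)\<^sup>2) + (\<Sum>i<n. (y i)\<^sup>2))"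
proof -
  define B where "B = \<alpha> * (2 * real r + 1) / 2 + l / 2 ^ r"
  define p where "p = (\<lambda>(z::nat \<Rightarrow> real) i. max (z i) 0)"
  define m where "m = (\<lambda>(z::nat \<Rightarrow> real) i. max (- z i) 0)"
  define b where "b = (\<lambda>u v. \<Sum>i<n. \<Sum>j<n. u i * M i j * v j)"
  define q where "q = (\<lambda>z::nat \<Rightarrow> real. \<Sum>i<n. (z i)\<^sup>2)"
  have bound: "\<bar>b u v\<bar> \<le> B * (q u + q v)" if "\<And>i. u i \<ge> 0" "\<And>i. v i \<ge> 0" for u v
    using bilinear_bound_nonneg[of u v r] that by (simp add: b_def q_def B_def)
  have pm: "p z i \<ge> 0" "m z i \<ge> 0" for z i by (auto simp: p_def m_def)
  have qsum: "q (p z) + q (m z) = q z" for z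
    unfolding q_def sum.distrib[symmetric]
    by (intro sum.cong refl) (auto simp: p_def m_def max_def)
  have split: "x = (\<lambda>i. p x i - m x i)" "y = (\<lambda>i. p y i - m y i)"
    by (auto simp: p_def m_def max_def)
  have "b x y = b (p x) (p y) - b (p x) (m y) - b (m x) (p y) + b (m x) (m y)"
    unfolding b_def sum.distrib[symmetric] sum_subtractf[symmetric]
    by (subst split(1), subst split(2)) (intro sum.cong refl, simp add: algebra_simps)
  then have "\<bar>b x y\<bar> \<le> \<bar>b (p x) (p y)\<bar> + \<bar>b (p x) (m y)\<bar> + \<bar>b (m x) (p y)\<bar> + \<bar>b (m x) (m y)\<bar>"
    by linarith
  also have "\<dots> \<le> B * (q (p x) + q (p y)) + B * (q (p x) + q (m y)) + B * (q (m x) + q (p y)) + B * (q (m x) + q (m y))"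
    by (intro add_mono bound pm)
  also have "\<dots> = 2 * B * ((q (p x) + q (m x)) + (q (p y) + q (m y)))" by (simp add: algebra_simps)
  finally show ?thesis by (simp add: qsum) (simp add: b_def q_def B_def)
qed

end

section \<open>Positivity of the certificate\<close>

lemma sum_sign_affine:
  fixes s :: "nat \<Rightarrow> real"
  assumes "(\<Sum>i<n. s i) = m"
  shows "(\<Sum>i<n. c + e * s i) = c * real n + e * m"
  unfolding sum.distrib sum_distrib_left[symmetric] assms by simp

text \<open>The fluctuation \<open>M\<close> costs \<open>2 * \<beta>\<close> on both
  \<open>U\<close> and \<open>W\<close> through the form \<open>x M x\<close>, and another
  \<open>2 + 1 / \<kappa>\<close> and 8 times \<beta> through the diagonal (\<open>fluct\<close>).
  This is the origin of the constants \<open>4 + 1 / \<kappa>\<close> and 10 in the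
  hypotheses.\<close>

lemma certificate_positive:
  fixes n K :: nat and s x :: "nat \<Rightarrow> real" and A :: "nat \<Rightarrow> nat \<Rightarrow> real" and p q lam \<kappa> \<beta> \<epsilon> :: real
  defines "m \<equiv> 2 * real K - real n"
  defines "d \<equiv> \<lambda>i. s i * (\<Sum>j<n. A i j * s j) - lam * m * s i"
  assumes s2: "\<And>i. i < n \<Longrightarrow> s i * s i = 1"
    and sum_s: "(\<Sum>i<n. s i) = m"
    and \<kappa>: "0 < \<kappa>" "\<kappa> * real n \<le> real K" "\<kappa> * real n \<le> real n - real K"
    and bil: "\<And>x y. \<bar>\<Sum>i<n. \<Sum>j<n. x i * (A i j - ((p + q) / 2 + (p - q) / 2 * (s i * s j))) * y j\<bar>
               \<le> \<beta> * ((\<Sum>i<n. (x i)\<^sup>2) + (\<Sum>i<n. (y i)\<^sup>2))"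
    and d_ge: "\<And>i. i < n \<Longrightarrow> \<epsilon> \<le> d i"
    and small_u: "\<beta> * (4 + 1 / \<kappa>) < real n * (lam - q)"
    and small_w: "10 * \<beta> < \<epsilon>" and \<beta>: "\<beta> \<ge> 0"
    and orth: "(\<Sum>i<n. x i * s i) = 0" and nz: "i0 < n" "x i0 \<noteq> 0"
  shows "0 < (\<Sum>i<n. \<Sum>j<n. x i * ((if i = j then d i else 0) - A i j + lam) * x j)"
proof -
  define M where "M = (\<lambda>i j. A i j - ((p + q) / 2 + (p - q) / 2 * (s i * s j)))"
  define X where "X = (\<Sum>i<n. x i)"
  have n: "real n > 0" using nz by simp
  have Kp: "0 < real K" "0 < real n - real K"
    using \<kappa> n by (smt (verit) mult_pos_pos)+
  \<comment> \<open>Gram determinant of the all-ones vector and \<open>s\<close>, positive because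
    both clusters are nonempty.\<close>
  define \<Delta> where "\<Delta> = (real n)\<^sup>2 - m\<^sup>2"
  have \<Delta>_eq: "\<Delta> = 4 * real K * (real n - real K)"
    by (simp add: \<Delta>_def m_def power2_eq_square algebra_simps)
  then have \<Delta>: "\<Delta> > 0" using Kp by simp
  \<comment> \<open>\<open>e\<close> and \<open>f\<close> solve the normal equations that make
    \<open>u\<close> the orthogonal projection of \<open>x\<close> onto the span of the all-ones
    vector and \<open>s\<close>; \<open>w\<close> is the residual.\<close>
  define e where "e = X * real n / \<Delta>"
  define f where "f = - (X * m / \<Delta>)"
  define u where "u = (\<lambda>i. e + f * s i)"
  define w where "w = (\<lambda>i. x i - u i)"
  have ef1: "e * m + f * real n = 0" by (simp add: e_def f_def)
  have ef2: "e * real n + f * m = X"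
  proof -
    have "e * real n + f * m = X * ((real n)\<^sup>2 - m\<^sup>2) / \<Delta>"
      by (simp add: e_def f_def power2_eq_square algebra_simps diff_divide_distrib)
    then show ?thesis using \<Delta> by (simp add: \<Delta>_def)
  qed
  have f_eq: "f = - (e * m / real n)" using ef1 n by (simp add: field_simps)
  have us: "u i * s i = f + e * s i" if "i < n" for i
    using s2[OF that] by (simp add: u_def algebra_simps)
  have u2: "(u i)\<^sup>2 = (e\<^sup>2 + f\<^sup>2) + 2 * e * f * s i" if "i < n" for i
  proof -
    have "(u i)\<^sup>2 = e\<^sup>2 + 2 * e * f * s i + f\<^sup>2 * (s i * s i)"
      by (simp add: u_def power2_eq_square algebra_simps)
    then show ?thesis using s2[OF that] by simp
  qed
  have sum_u: "(\<Sum>i<n. u i) = X"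
    unfolding u_def sum_sign_affine[OF sum_s] by (rule ef2)
  have sum_us: "(\<Sum>i<n. u i * s i) = 0"
  proof -
    have "(\<Sum>i<n. u i * s i) = (\<Sum>i<n. f + e * s i)"
      by (intro sum.cong refl) (simp add: us)
    then show ?thesis using sum_sign_affine[OF sum_s] ef1 by (simp add: mult_ac)
  qed
  have sum_w: "(\<Sum>i<n. w i) = 0"
    by (simp add: w_def sum_subtractf sum_u) (simp add: X_def)
  have sum_ws: "(\<Sum>i<n. w i * s i) = 0"
    by (simp add: w_def sum_subtractf left_diff_distrib sum_us orth)
  have w_span: "(\<Sum>i<n. w i * (c + h * s i)) = 0" for c h
  proof -
    have "(\<Sum>i<n. w i * (c + h * s i)) = c * (\<Sum>i<n. w i) + h * (\<Sum>i<n. w i * s i)"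
      by (simp add: sum.distrib sum_distrib_left algebra_simps)
    then show ?thesis by (simp add: sum_w sum_ws)
  qed
  define U where "U = (\<Sum>i<n. (u i)\<^sup>2)"
  define W where "W = (\<Sum>i<n. (w i)\<^sup>2)"
  have U_eq: "U = (e\<^sup>2 + f\<^sup>2) * real n + 2 * e * f * m"
  proof -
    have "U = (\<Sum>i<n. (e\<^sup>2 + f\<^sup>2) + (2 * e * f) * s i)"
      unfolding U_def by (intro sum.cong refl) (simp add: u2)
    then show ?thesis by (simp only: sum_sign_affine[OF sum_s])
  qed
  have xx: "(\<Sum>i<n. (x i)\<^sup>2) = U + W"
  proof -
    have "(\<Sum>i<n. (x i)\<^sup>2) = (\<Sum>i<n. (u i)\<^sup>2 + (w i)\<^sup>2 + 2 * (w i * (e + f * s i)))"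
      by (intro sum.cong refl) (simp add: w_def u_def power2_eq_square algebra_simps)
    also have "\<dots> = U + W + 2 * (\<Sum>i<n. w i * (e + f * s i))"
      by (simp add: sum.distrib U_def W_def sum_distrib_left)
    finally show ?thesis by (simp add: w_span)
  qed
  have UW: "U \<ge> 0" "W \<ge> 0" by (simp_all add: U_def W_def sum_nonneg)
  have pos: "U + W > 0"
  proof -
    have "0 < (x i0)\<^sup>2" using nz by simp
    also have "\<dots> \<le> (\<Sum>i<n. (x i)\<^sup>2)" using nz by (intro member_le_sum) auto
    finally show ?thesis using xx by simp
  qed
  \<comment> \<open>\<open>dbar\<close> is what \<open>d\<close> becomes when \<open>A\<close> is
    replaced by its block mean; \<open>\<mu>\<close> is the contribution of the fluctuation.\<close>
  define dbar where "dbar = (\<lambda>i. (p - q) / 2 * real n + ((p + q) / 2 - lam) * m * s i)"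
  define \<mu> where "\<mu> = (\<lambda>i. s i * (\<Sum>j<n. M i j * s j))"
  have d_split: "d i = dbar i + \<mu> i" if "i < n" for i
  proof -
    have "(\<Sum>j<n. A i j * s j) = (\<Sum>j<n. M i j * s j + ((p - q) / 2 * s i * (s j * s j) + (p + q) / 2 * s j))"
      by (intro sum.cong refl) (simp add: M_def algebra_simps)
    also have "\<dots> = (\<Sum>j<n. M i j * s j) + (\<Sum>j<n. (p - q) / 2 * s i * (s j * s j) + (p + q) / 2 * s j)"
      by (rule sum.distrib)
    also have "(\<Sum>j<n. (p - q) / 2 * s i * (s j * s j) + (p + q) / 2 * s j) = (\<Sum>j<n. (p - q) / 2 * s i + (p + q) / 2 * s j)"
      by (intro sum.cong refl) (simp add: s2)
    also have "\<dots> = (p - q) / 2 * s i * real n + (p + q) / 2 * m"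
      by (rule sum_sign_affine[OF sum_s])
    finally have "d i = \<mu> i + ((p - q) / 2 * real n * (s i * s i) + (p + q) / 2 * m * s i) - lam * m * s i"
      by (simp add: d_def \<mu>_def algebra_simps)
    then show ?thesis using s2[OF that] by (simp add: dbar_def algebra_simps)
  qed
  \<comment> \<open>The left side is the form at \<open>u\<close> of the mean of the certificate;
    its term with the inner product of \<open>u\<close> and \<open>s\<close> is absent because
    \<open>u\<close> is orthogonal to \<open>s\<close>.\<close>
  have mean_form: "(\<Sum>i<n. (u i)\<^sup>2 * dbar i) - ((p + q) / 2 - lam) * X\<^sup>2 = real n * (lam - q) * U"
  proof -
    define c1 where "c1 = (p - q) / 2 * real n"
    define c2 where "c2 = ((p + q) / 2 - lam) * m"
    have "(\<Sum>i<n. (u i)\<^sup>2 * dbar i)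
        = (\<Sum>i<n. ((e\<^sup>2 + f\<^sup>2) * c1 + 2 * e * f * c2) + ((e\<^sup>2 + f\<^sup>2) * c2 + 2 * e * f * c1) * s i)"
    proof (intro sum.cong refl)
      fix i assume "i \<in> {..<n}"
      then have i: "i < n" by simp
      have "(u i)\<^sup>2 * dbar i = ((e\<^sup>2 + f\<^sup>2) + 2 * e * f * s i) * (c1 + c2 * s i)"
        using u2[OF i] by (simp add: dbar_def c1_def c2_def)
      also have "\<dots> = (e\<^sup>2 + f\<^sup>2) * c1 + 2 * e * f * c2 * (s i * s i) + ((e\<^sup>2 + f\<^sup>2) * c2 + 2 * e * f * c1) * s i"
        by (simp add: algebra_simps)
      finally show "(u i)\<^sup>2 * dbar i = ((e\<^sup>2 + f\<^sup>2) * c1 + 2 * e * f * c2) + ((e\<^sup>2 + f\<^sup>2) * c2 + 2 * e * f * c1) * s i"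
        using s2[OF i] by simp
    qed
    also have "\<dots> = ((e\<^sup>2 + f\<^sup>2) * c1 + 2 * e * f * c2) * real n + ((e\<^sup>2 + f\<^sup>2) * c2 + 2 * e * f * c1) * m"
      by (rule sum_sign_affine[OF sum_s])
    finally have 1: "(\<Sum>i<n. (u i)\<^sup>2 * dbar i) = \<dots>" .
    define N where "N = real n"
    have N: "N > 0" using n by (simp add: N_def)
    \<comment> \<open>Vectors in the span that are orthogonal to \<open>s\<close> form a line.
      Parametrising it by \<open>g\<close> turns the claim into a polynomial identity.\<close>
    define g where "g = e / N"
    have e: "e = g * N" and f: "f = - (g * m)"
      using N f_eq by (auto simp: g_def N_def)
    show ?thesis
      unfolding 1 U_eq ef2[symmetric] c1_def c2_def N_def[symmetric] e f
      by (simp add: power2_eq_square field_simps)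
  qed
  \<comment> \<open>\<open>u\<close> takes only the values \<open>e + f\<close> and
    \<open>e - f\<close>, so \<open>G\<close> bounds every squared entry. As each cluster has at
    least \<open>\<kappa> * n\<close> vertices, \<open>n * G\<close> is still controlled by
    \<open>U\<close>.\<close>
  define G where "G = (e + f)\<^sup>2 + (e - f)\<^sup>2"
  have u_le_G: "(u i)\<^sup>2 \<le> G" if "i < n" for i
  proof -
    have "s i = 1 \<or> s i = -1" using s2[OF that] by (simp add: square_eq_1_iff)
    then show ?thesis by (auto simp: u_def G_def)
  qed
  have G_le: "real n * G \<le> U / \<kappa>"
  proof -
    have "\<kappa> * real n * G \<le> real K * (e + f)\<^sup>2 + (real n - real K) * (e - f)\<^sup>2"
      unfolding G_def distrib_left using \<kappa> by (intro add_mono mult_right_mono) auto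
    also have "\<dots> = U"
      unfolding U_eq m_def by (simp add: power2_eq_square algebra_simps)
    finally show ?thesis using \<kappa> by (simp add: field_simps)
  qed
  have G0: "G \<ge> 0" by (simp add: G_def)
  have fluct: "\<bar>\<Sum>i<n. ((u i)\<^sup>2 + 2 * u i * w i) * \<mu> i\<bar> \<le> \<beta> * ((2 + 1 / \<kappa>) * U + 8 * W)"
  proof -
    \<comment> \<open>The diagonal fluctuation is read as the form of \<open>M\<close> between
      \<open>y\<close> and \<open>g * s\<close>. Dividing by \<open>g = sqrt G\<close> balances the
      arguments: the squared norm of \<open>y\<close> is at most \<open>2 * U + 8 * W\<close>, that
      of \<open>g * s\<close> at most \<open>U / \<kappa>\<close>. If \<open>g = 0\<close>, then
      \<open>u\<close> and \<open>y\<close> vanish.\<close>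
    define g where "g = sqrt G"
    define y where "y = (\<lambda>i. s i * ((u i)\<^sup>2 + 2 * u i * w i) / g)"
    have g2: "g * g = G" using G0 by (simp add: g_def)
    have yg: "y i * g = s i * ((u i)\<^sup>2 + 2 * u i * w i)" if "i < n" for i
    proof (cases "g = 0")
      case True
      then have "G = 0" using g2 by simp
      then have "u i = 0" using u_le_G[OF that] by simp
      then show ?thesis by (simp add: y_def)
    qed (simp add: y_def)
    have y_le: "(y i)\<^sup>2 \<le> 2 * (u i)\<^sup>2 + 8 * (w i)\<^sup>2" if "i < n" for i
    proof (cases "g = 0")
      case False
      then have "G > 0" using G0 g2 by (metis less_eq_real_def mult_eq_0_iff)
      have "(y i)\<^sup>2 = (s i * s i) * ((u i)\<^sup>2 / G) * (u i + 2 * w i)\<^sup>2"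
        by (simp add: y_def power2_eq_square algebra_simps add_divide_distrib g2[symmetric])
      also have "\<dots> \<le> 1 * (u i + 2 * w i)\<^sup>2"
        using u_le_G[OF that] \<open>G > 0\<close> s2[OF that] by (intro mult_right_mono) auto
      also have "\<dots> \<le> 2 * (u i)\<^sup>2 + 8 * (w i)\<^sup>2"
        using zero_le_power2[of "u i - 2 * w i"] by (simp add: power2_eq_square algebra_simps)
      finally show ?thesis .
    qed (simp add: y_def)
    have "(\<Sum>i<n. ((u i)\<^sup>2 + 2 * u i * w i) * \<mu> i) = (\<Sum>i<n. \<Sum>j<n. y i * M i j * (g * s j))"
    proof (intro sum.cong refl)
      fix i assume "i \<in> {..<n}"
      then have i: "i < n" by simp
      have "(\<Sum>j<n. y i * M i j * (g * s j)) = (y i * g) * (\<Sum>j<n. M i j * s j)"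
        by (simp add: sum_distrib_left mult_ac)
      also have "\<dots> = ((u i)\<^sup>2 + 2 * u i * w i) * \<mu> i"
        unfolding yg[OF i] \<mu>_def by (simp add: mult_ac)
      finally show "((u i)\<^sup>2 + 2 * u i * w i) * \<mu> i = (\<Sum>j<n. y i * M i j * (g * s j))" ..
    qed
    then have "\<bar>\<Sum>i<n. ((u i)\<^sup>2 + 2 * u i * w i) * \<mu> i\<bar> \<le> \<beta> * ((\<Sum>i<n. (y i)\<^sup>2) + (\<Sum>i<n. (g * s i)\<^sup>2))"
      using bil[of y "\<lambda>j. g * s j"] by (simp add: M_def)
    also have "\<dots> \<le> \<beta> * ((2 * U + 8 * W) + U / \<kappa>)"
    proof (intro mult_left_mono add_mono \<beta>)
      have "(\<Sum>i<n. (y i)\<^sup>2) \<le> (\<Sum>i<n. 2 * (u i)\<^sup>2 + 8 * (w i)\<^sup>2)"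
        by (intro sum_mono) (simp add: y_le)
      also have "\<dots> = 2 * U + 8 * W" by (simp add: U_def W_def sum.distrib sum_distrib_left)
      finally show "(\<Sum>i<n. (y i)\<^sup>2) \<le> 2 * U + 8 * W" .
      have "(\<Sum>i<n. (g * s i)\<^sup>2) = (\<Sum>i<n. G)"
      proof (intro sum.cong refl)
        fix i assume "i \<in> {..<n}"
        then have "s i * s i = 1" by (simp add: s2)
        have "(g * s i)\<^sup>2 = (g * g) * (s i * s i)" by (simp add: power2_eq_square)
        then show "(g * s i)\<^sup>2 = G" using \<open>s i * s i = 1\<close> g2 by simp
      qed
      then show "(\<Sum>i<n. (g * s i)\<^sup>2) \<le> U / \<kappa>" using G_le by simp
    qed
    finally show ?thesis by (simp add: algebra_simps)
  qed
  have xMx: "(\<Sum>i<n. \<Sum>j<n. x i * M i j * x j) \<le> 2 * \<beta> * (U + W)"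
    using bil[of x x] by (simp add: M_def xx algebra_simps)
  have diag: "(\<Sum>i<n. (x i)\<^sup>2 * d i) \<ge> (\<Sum>i<n. (u i)\<^sup>2 * dbar i) - \<beta> * ((2 + 1 / \<kappa>) * U + 8 * W) + \<epsilon> * W"
  proof -
    \<comment> \<open>The product of \<open>u\<close> and \<open>dbar\<close> is again a combination
      of the all-ones vector and \<open>s\<close>, to which \<open>w\<close> is orthogonal.\<close>
    have udb: "(\<Sum>i<n. w i * (u i * dbar i)) = 0"
    proof -
      define c1 where "c1 = (p - q) / 2 * real n"
      define c2 where "c2 = ((p + q) / 2 - lam) * m"
      have "(\<Sum>i<n. w i * (u i * dbar i)) = (\<Sum>i<n. w i * ((e * c1 + f * c2) + (f * c1 + e * c2) * s i))"
      proof (intro sum.cong refl arg_cong2[where f = "(*)"])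
        fix i assume "i \<in> {..<n}"
        then have i: "i < n" by simp
        have "u i * dbar i = e * c1 + f * c2 * (s i * s i) + (f * c1 + e * c2) * s i"
          unfolding u_def dbar_def c1_def[symmetric] c2_def[symmetric] by (simp add: algebra_simps)
        then show "u i * dbar i = (e * c1 + f * c2) + (f * c1 + e * c2) * s i"
          using s2[OF i] by simp
      qed
      then show ?thesis by (simp only: w_span)
    qed
    have "(\<Sum>i<n. (x i)\<^sup>2 * d i)
        = (\<Sum>i<n. (w i)\<^sup>2 * d i + (u i)\<^sup>2 * dbar i + 2 * (w i * (u i * dbar i)) + ((u i)\<^sup>2 + 2 * u i * w i) * \<mu> i)"
    proof (intro sum.cong refl)
      fix i assume "i \<in> {..<n}"
      then have i: "i < n" by simp
      have "(x i)\<^sup>2 = (w i)\<^sup>2 + (u i)\<^sup>2 + 2 * u i * w i"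
        by (simp add: w_def power2_eq_square algebra_simps)
      then have "(x i)\<^sup>2 * d i = (w i)\<^sup>2 * d i + ((u i)\<^sup>2 + 2 * u i * w i) * (dbar i + \<mu> i)"
        by (simp add: d_split[OF i] algebra_simps)
      then show "(x i)\<^sup>2 * d i = (w i)\<^sup>2 * d i + (u i)\<^sup>2 * dbar i + 2 * (w i * (u i * dbar i)) + ((u i)\<^sup>2 + 2 * u i * w i) * \<mu> i"
        by (simp add: algebra_simps)
    qed
    also have "\<dots> = (\<Sum>i<n. (w i)\<^sup>2 * d i) + (\<Sum>i<n. (u i)\<^sup>2 * dbar i)
        + 2 * (\<Sum>i<n. w i * (u i * dbar i)) + (\<Sum>i<n. ((u i)\<^sup>2 + 2 * u i * w i) * \<mu> i)"
      by (simp only: sum.distrib sum_distrib_left)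
    finally have "(\<Sum>i<n. (x i)\<^sup>2 * d i) = (\<Sum>i<n. (w i)\<^sup>2 * d i) + (\<Sum>i<n. (u i)\<^sup>2 * dbar i)
        + (\<Sum>i<n. ((u i)\<^sup>2 + 2 * u i * w i) * \<mu> i)" by (simp add: udb)
    moreover have "\<epsilon> * W \<le> (\<Sum>i<n. (w i)\<^sup>2 * d i)"
      unfolding W_def sum_distrib_left
      by (intro sum_mono) (simp add: mult.commute mult_right_mono d_ge)
    ultimately show ?thesis using fluct by linarith
  qed
  have "(\<Sum>i<n. \<Sum>j<n. x i * ((if i = j then d i else 0) - A i j + lam) * x j)
      = (\<Sum>i<n. \<Sum>j<n. (if i = j then (x i)\<^sup>2 * d i else 0) - x i * M i j * x j
          - ((p + q) / 2 - lam) * (x i * x j) - (p - q) / 2 * ((x i * s i) * (x j * s j)))"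
  proof (intro sum.cong refl)
    fix i j
    define h1 where "h1 = (p + q) / 2"
    define h2 where "h2 = (p - q) / 2"
    have A: "A i j = M i j + (h1 + h2 * (s i * s j))" by (simp add: M_def h1_def h2_def)
    show "x i * ((if i = j then d i else 0) - A i j + lam) * x j = (if i = j then (x i)\<^sup>2 * d i else 0) - x i * M i j * x j
          - ((p + q) / 2 - lam) * (x i * x j) - (p - q) / 2 * ((x i * s i) * (x j * s j))"
      unfolding A h1_def[symmetric] h2_def[symmetric]
      by (cases "i = j") (simp_all add: power2_eq_square algebra_simps)
  qed
  also have "\<dots> = (\<Sum>i<n. (x i)\<^sup>2 * d i) - (\<Sum>i<n. \<Sum>j<n. x i * M i j * x j)
      - ((p + q) / 2 - lam) * X\<^sup>2 - (p - q) / 2 * (\<Sum>i<n. x i * s i)\<^sup>2"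
  proof -
    have sq: "(\<Sum>i<n. \<Sum>j<n. h * (z i * z j)) = h * (\<Sum>i<n. z i)\<^sup>2" for h :: real and z :: "nat \<Rightarrow> real"
      unfolding power2_eq_square sum_product by (simp only: sum_distrib_left)
    have "(\<Sum>i<n. \<Sum>j<n. if i = j then (x i)\<^sup>2 * d i else 0) = (\<Sum>i<n. (x i)\<^sup>2 * d i)"
      by (simp add: sum.delta)
    then show ?thesis
      unfolding sum_subtractf sq X_def by simp
  qed
  finally have form: "(\<Sum>i<n. \<Sum>j<n. x i * ((if i = j then d i else 0) - A i j + lam) * x j)
      = (\<Sum>i<n. (x i)\<^sup>2 * d i) - (\<Sum>i<n. \<Sum>j<n. x i * M i j * x j) - ((p + q) / 2 - lam) * X\<^sup>2"
    by (simp add: orth)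
  have "\<dots> \<ge> real n * (lam - q) * U - \<beta> * ((2 + 1 / \<kappa>) * U + 8 * W) + \<epsilon> * W - 2 * \<beta> * (U + W)"
    using diag xMx mean_form by linarith
  moreover have "real n * (lam - q) * U - \<beta> * ((2 + 1 / \<kappa>) * U + 8 * W) + \<epsilon> * W - 2 * \<beta> * (U + W)
      = (real n * (lam - q) - \<beta> * (4 + 1 / \<kappa>)) * U + (\<epsilon> - 10 * \<beta>) * W"
    by (simp add: algebra_simps)
  moreover have "\<dots> > 0"
    using UW pos small_u small_w
    by (cases "U = 0") (auto intro: add_pos_nonneg)
  ultimately show ?thesis using form by linarith
qed

text \<open>The diagonal is forced by the requirement that the labeling lie in the kernel of the
  certificate. What remains are conditions on \<open>A\<close> that can be checked with high
  probability: a norm bound for the deviation and a lower bound on the diagonal.\<close>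

theorem sdp_unique_opt_deterministic:
  fixes \<sigma> :: "nat \<Rightarrow> int" and A :: "nat \<Rightarrow> nat \<Rightarrow> real" and p q lam \<kappa> \<beta> \<epsilon> :: real
  assumes lab: "\<sigma> \<in> labelings n K"
    and symA: "\<And>i j. i < n \<Longrightarrow> j < n \<Longrightarrow> A i j = A j i"
    and \<kappa>: "0 < \<kappa>" "\<kappa> * real n \<le> real K" "\<kappa> * real n \<le> real n - real K"
    and bil: "\<And>x y. \<bar>\<Sum>i<n. \<Sum>j<n. x i * (A i j - (if \<sigma> i = \<sigma> j then p else q)) * y j\<bar>
               \<le> \<beta> * ((\<Sum>i<n. (x i)\<^sup>2) + (\<Sum>i<n. (y i)\<^sup>2))"
    and d_ge: "\<And>i. i < n \<Longrightarrow> \<epsilon> \<le> (\<Sum>j<n. A i j * real_of_int (\<sigma> i * \<sigma> j)) - lam * (2 * real K - real n) * real_of_int (\<sigma> i)"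
    and small: "\<beta> * (4 + 1 / \<kappa>) < real n * (lam - q)" "10 * \<beta> < \<epsilon>" "\<beta> \<ge> 0"
  shows "sdp_unique_opt n K A (Ystar \<sigma>)"
proof -
  define s where "s = (\<lambda>i. real_of_int (\<sigma> i))"
  define m where "m = 2 * real K - real n"
  define d where "d = (\<lambda>i. s i * (\<Sum>j<n. A i j * s j) - lam * m * s i)"
  have s2: "s i * s i = 1" if "i < n" for i
    using labelings_square[OF lab that] by (simp add: s_def)
  have sum_s: "(\<Sum>i<n. s i) = m"
    using labelings_sum[OF lab] by (simp add: s_def m_def)
  have cases: "\<sigma> i = 1 \<or> \<sigma> i = -1" if "i < n" for i
    using lab that by (auto simp: labelings_def)
  have mean: "(if \<sigma> i = \<sigma> j then p else q) = (p + q) / 2 + (p - q) / 2 * (s i * s j)" if "i < n" "j < n" for i j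
    using cases[OF that(1)] cases[OF that(2)] by (auto simp: s_def field_simps)
  have bil': "\<bar>\<Sum>i<n. \<Sum>j<n. x i * (A i j - ((p + q) / 2 + (p - q) / 2 * (s i * s j))) * y j\<bar>
               \<le> \<beta> * ((\<Sum>i<n. (x i)\<^sup>2) + (\<Sum>i<n. (y i)\<^sup>2))" for x y
  proof -
    have "(\<Sum>i<n. \<Sum>j<n. x i * (A i j - ((p + q) / 2 + (p - q) / 2 * (s i * s j))) * y j)
        = (\<Sum>i<n. \<Sum>j<n. x i * (A i j - (if \<sigma> i = \<sigma> j then p else q)) * y j)"
      by (intro sum.cong refl) (simp only: mean lessThan_iff)
    then show ?thesis using bil[of x y] by simp
  qed
  have d_ge': "\<epsilon> \<le> d i" if "i < n" for i
    using d_ge[OF that] by (simp add: d_def s_def m_def sum_distrib_left mult_ac)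
  show ?thesis
  proof (rule sdp_dual_certificate[OF lab symA, where d = d and lam = lam])
    fix i assume i: "i < n"
    have "(\<Sum>j<n. ((if i = j then d i else 0) - A i j + lam) * s j)
        = (\<Sum>j<n. (if i = j then d i * s i else 0) - A i j * s j + lam * s j)"
      by (intro sum.cong refl) (auto simp: algebra_simps)
    also have "\<dots> = d i * s i - (\<Sum>j<n. A i j * s j) + lam * m"
      using i by (simp add: sum.distrib sum_subtractf sum_distrib_left[symmetric] sum_s)
    also have "d i * s i = (s i * s i) * ((\<Sum>j<n. A i j * s j) - lam * m)"
      by (simp add: d_def algebra_simps)
    finally show "(\<Sum>j<n. ((if i = j then d i else 0) - A i j + lam) * real_of_int (\<sigma> j)) = 0"
      using s2[OF i] by (simp add: s_def)
  next
    fix x :: "nat \<Rightarrow> real" and i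
    assume x: "(\<Sum>i<n. x i * real_of_int (\<sigma> i)) = 0" "i < n" "x i \<noteq> 0"
    show "0 < (\<Sum>i<n. \<Sum>j<n. x i * ((if i = j then d i else 0) - A i j + lam) * x j)"
      unfolding d_def m_def
    proof (rule certificate_positive[where s = s and p = p and q = q and \<kappa> = \<kappa> and \<beta> = \<beta> and \<epsilon> = \<epsilon> and ?i0.0 = i])
      show "(\<Sum>i<n. s i) = 2 * real K - real n" using sum_s by (simp add: m_def)
      show "(\<Sum>i<n. x i * s i) = 0" using x(1) by (simp add: s_def)
      show "\<epsilon> \<le> s i * (\<Sum>j<n. A i j * s j) - lam * (2 * real K - real n) * s i" if "i < n" for i
        using d_ge'[OF that] by (simp add: d_def m_def)
      show "s i * s i = 1" if "i < n" for i by (rule s2[OF that])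
      show "\<bar>\<Sum>i<n. \<Sum>j<n. x i * (A i j - ((p + q) / 2 + (p - q) / 2 * (s i * s j))) * y j\<bar>
               \<le> \<beta> * ((\<Sum>i<n. (x i)\<^sup>2) + (\<Sum>i<n. (y i)\<^sup>2))" for x y
        by (rule bil')
    qed (use \<kappa> small x in auto)
  qed
qed

section \<open>Exponential moments in the block model\<close>

text \<open>This is the independence of the edges: a sum over all graphs of a product over pairs
  factorises.\<close>

lemma sum_Pow_prod_choice:
  fixes f g :: "'a \<Rightarrow> real"
  assumes "finite P"
  shows "(\<Sum>E\<in>Pow P. \<Prod>e\<in>P. if e \<in> E then f e else g e) = (\<Prod>e\<in>P. f e + g e)"
proof -
  have "(\<Prod>e\<in>P. if e \<in> E then f e else g e) = prod f E * prod g (P - E)" if "E \<in> Pow P" for E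
  proof -
    have "P \<inter> {e. e \<in> E} = E" "P \<inter> - {e. e \<in> E} = P - E" using that by auto
    then show ?thesis using assms by (simp add: prod.If_cases)
  qed
  then have "(\<Sum>E\<in>Pow P. \<Prod>e\<in>P. if e \<in> E then f e else g e) = (\<Sum>E\<in>Pow P. prod f E * prod g (P - E))"
    by (rule sum.cong[OF refl])
  then show ?thesis using prod_add[OF assms, of f g] by simp
qed

lemma finite_pairs [simp]: "finite (pairs n)"
  by (rule finite_subset[of _ "{..<n} \<times> {..<n}"]) (auto simp: pairs_def)

lemma pairs_Suc: "pairs (Suc n) = pairs n \<union> (\<lambda>i. (i, n)) ` {..<n}"
  by (auto simp: pairs_def less_Suc_eq)

text \<open>Graphs live on pairs with \<open>i < j\<close>, matrix statistics on all ordered pairs;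
  this converts between the two.\<close>

lemma sum_pairs_symmetrize:
  fixes H :: "nat \<Rightarrow> nat \<Rightarrow> real"
  shows "(\<Sum>(u, v)\<in>pairs n. H u v + H v u) = (\<Sum>i<n. \<Sum>j<n. if i \<noteq> j then H i j else 0)"
proof (induction n)
  case 0
  then show ?case by (simp add: pairs_def)
next
  case (Suc n)
  have "(\<Sum>(u, v)\<in>pairs (Suc n). H u v + H v u)
      = (\<Sum>(u, v)\<in>pairs n. H u v + H v u) + (\<Sum>(u, v)\<in>(\<lambda>i. (i, n)) ` {..<n}. H u v + H v u)"
    unfolding pairs_Suc by (rule sum.union_disjoint) (auto simp: pairs_def[of n] finite_pairs[unfolded pairs_def])
  also have "(\<Sum>(u, v)\<in>(\<lambda>i. (i, n)) ` {..<n}. H u v + H v u) = (\<Sum>i<n. H i n + H n i)"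
    by (subst sum.reindex) (auto simp: inj_on_def)
  also have "(\<Sum>i<n. H i n + H n i) = (\<Sum>i<n. if i \<noteq> n then H i n else 0) + (\<Sum>j<n. if n \<noteq> j then H n j else 0)"
    unfolding sum.distrib by (intro arg_cong2[where f = "(+)"] sum.cong) auto
  finally show ?case by (simp add: Suc.IH sum.distrib)
qed

lemma adj_sym: "adj E i j = adj E j i"
  by (simp add: adj_def min.commute max.commute eq_commute)

lemma adj_linear_statistic:
  assumes "E \<subseteq> pairs n"
  shows "(\<Sum>i<n. \<Sum>j<n. B i j * adj E i j) = (\<Sum>e\<in>E. B (fst e) (snd e) + B (snd e) (fst e))"
proof -
  have "(\<Sum>i<n. \<Sum>j<n. B i j * adj E i j) = (\<Sum>i<n. \<Sum>j<n. if i \<noteq> j then B i j * adj E i j else 0)"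
    by (intro sum.cong refl) (auto simp: adj_def)
  also have "\<dots> = (\<Sum>(u, v)\<in>pairs n. B u v * adj E u v + B v u * adj E v u)"
    by (rule sum_pairs_symmetrize[symmetric])
  also have "\<dots> = (\<Sum>e\<in>pairs n. if e \<in> E then B (fst e) (snd e) + B (snd e) (fst e) else 0)"
    by (intro sum.cong refl) (auto simp: pairs_def adj_def)
  also have "\<dots> = (\<Sum>e\<in>E. B (fst e) (snd e) + B (snd e) (fst e))"
    using assms by (simp add: sum.If_cases Int_absorb1)
  finally show ?thesis .
qed

lemma edge_prob_sym: "edge_prob n a b \<sigma> i j = edge_prob n a b \<sigma> j i"
  by (simp add: edge_prob_def eq_commute)

lemma finite_events: "finite {E. E \<subseteq> pairs n \<and> Q E}"
  by (rule finite_subset[of _ "Pow (pairs n)"]) auto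

lemma sbm_weight_alt:
  "sbm_weight n a b \<sigma> E = (\<Prod>e\<in>pairs n. if e \<in> E then edge_prob n a b \<sigma> (fst e) (snd e) else 1 - edge_prob n a b \<sigma> (fst e) (snd e))"
  unfolding sbm_weight_def by (intro prod.cong) auto

lemma sbm_weight_total: "(\<Sum>E\<in>Pow (pairs n). sbm_weight n a b \<sigma> E) = 1"
  unfolding sbm_weight_alt by (simp add: sum_Pow_prod_choice)

lemma sbm_prob_compl: "sbm_prob n a b \<sigma> P = 1 - sbm_prob n a b \<sigma> (\<lambda>A. \<not> P A)"
proof -
  have "Pow (pairs n) = {E. E \<subseteq> pairs n \<and> P (adj E)} \<union> {E. E \<subseteq> pairs n \<and> \<not> P (adj E)}" by auto
  then have "(\<Sum>E\<in>Pow (pairs n). sbm_weight n a b \<sigma> E) = sbm_prob n a b \<sigma> P + sbm_prob n a b \<sigma> (\<lambda>A. \<not> P A)"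
    unfolding sbm_prob_def by (simp only:) (rule sum.union_disjoint, auto simp: finite_events)
  then show ?thesis by (simp add: sbm_weight_total)
qed

text \<open>The assumptions place all edge probabilities between 0 and 1, so the weights are
  nonnegative and the union bound is available. For fixed \<open>a\<close> the condition
  \<open>small\<close> holds for all large \<open>n\<close>.\<close>

locale sbm =
  fixes n :: nat and a b :: real and \<sigma> :: "nat \<Rightarrow> int"
  assumes ab: "0 < b" "b < a" and small: "a * ln (real n) / real n \<le> 1" and n_pos: "n \<ge> 1"
begin

abbreviation "r \<equiv> edge_prob n a b \<sigma>"
abbreviation "Pr \<equiv> sbm_prob n a b \<sigma>"

lemma r_nonneg: "0 \<le> r i j"
  using ab n_pos by (auto simp: edge_prob_def)

lemma r_le: "r i j \<le> a * ln (real n) / real n"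
  using ab n_pos by (auto simp: edge_prob_def intro!: divide_right_mono mult_right_mono)

lemma r_le_1: "r i j \<le> 1"
  using r_le small by (rule order.trans)

lemma weight_nonneg: "0 \<le> sbm_weight n a b \<sigma> E"
  unfolding sbm_weight_def using r_nonneg r_le_1 by (intro prod_nonneg) (auto split: prod.splits)

lemma Pr_mono:
  assumes "\<And>E. E \<subseteq> pairs n \<Longrightarrow> P (adj E) \<Longrightarrow> Q (adj E)"
  shows "Pr P \<le> Pr Q"
  unfolding sbm_prob_def using assms by (intro sum_mono2 finite_events weight_nonneg) auto

lemma Pr_disj: "Pr (\<lambda>A. P A \<or> Q A) \<le> Pr P + Pr Q"
proof -
  have "{E. E \<subseteq> pairs n \<and> (P (adj E) \<or> Q (adj E))} = {E. E \<subseteq> pairs n \<and> P (adj E)} \<union> {E. E \<subseteq> pairs n \<and> Q (adj E)}"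
    by auto
  then show ?thesis
    unfolding sbm_prob_def
    by (simp add: sum_Un finite_events sum_nonneg weight_nonneg)
qed

lemma Pr_False: "Pr (\<lambda>_. False) = 0"
  by (simp add: sbm_prob_def)

lemma Pr_union:
  assumes "finite I"
  shows "Pr (\<lambda>A. \<exists>i\<in>I. P i A) \<le> (\<Sum>i\<in>I. Pr (P i))"
  using assms
proof (induction I rule: finite_induct)
  case empty
  then show ?case by (simp add: Pr_False)
next
  case (insert i I)
  have "Pr (\<lambda>A. \<exists>j\<in>insert i I. P j A) \<le> Pr (P i) + Pr (\<lambda>A. \<exists>j\<in>I. P j A)"
    using Pr_disj[of "P i" "\<lambda>A. \<exists>j\<in>I. P j A"] by simp
  then show ?case using insert by simp
qed

section \<open>Chernoff bounds for linear statistics\<close>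

text \<open>Markov's inequality is applied to the exponential of the statistic, whose expectation
  factorises over the pairs; each factor is then bounded by \<open>1 + x \<le> exp x\<close>. As
  \<open>B\<close> may be asymmetric, a pair carries the weight
  \<open>B i j + B j i\<close>.\<close>

lemma exponential_markov:
  assumes "\<And>E. E \<subseteq> pairs n \<Longrightarrow> P (adj E) \<Longrightarrow> t \<le> (\<Sum>i<n. \<Sum>j<n. B i j * adj E i j)"
  shows "Pr P \<le> exp ((\<Sum>(i, j)\<in>pairs n. r i j * (exp (B i j + B j i) - 1)) - t)"
proof -
  define c where "c = (\<lambda>e. B (fst e) (snd e) + B (snd e) (fst e))"
  define \<pi> where "\<pi> = (\<lambda>e. r (fst e) (snd e))"
  have w: "sbm_weight n a b \<sigma> E = (\<Prod>e\<in>pairs n. if e \<in> E then \<pi> e else 1 - \<pi> e)" for E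
    unfolding sbm_weight_alt \<pi>_def ..
  have "Pr P \<le> (\<Sum>E\<in>{E. E \<subseteq> pairs n \<and> P (adj E)}. sbm_weight n a b \<sigma> E * exp ((\<Sum>e\<in>E. c e) - t))"
    unfolding sbm_prob_def
  proof (intro sum_mono)
    fix E assume E: "E \<in> {E. E \<subseteq> pairs n \<and> P (adj E)}"
    then have "t \<le> (\<Sum>e\<in>E. c e)"
      using assms[of E] adj_linear_statistic[of E n B] by (simp add: c_def)
    then show "sbm_weight n a b \<sigma> E \<le> sbm_weight n a b \<sigma> E * exp ((\<Sum>e\<in>E. c e) - t)"
      using mult_left_mono[of 1 "exp ((\<Sum>e\<in>E. c e) - t)" "sbm_weight n a b \<sigma> E"] weight_nonneg[of E] by simp
  qed
  also have "\<dots> \<le> (\<Sum>E\<in>Pow (pairs n). sbm_weight n a b \<sigma> E * exp ((\<Sum>e\<in>E. c e) - t))"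
    by (intro sum_mono2) (auto simp: weight_nonneg)
  also have "\<dots> = exp (- t) * (\<Sum>E\<in>Pow (pairs n). \<Prod>e\<in>pairs n. if e \<in> E then \<pi> e * exp (c e) else 1 - \<pi> e)"
    unfolding sum_distrib_left
  proof (intro sum.cong refl)
    fix E assume E: "E \<in> Pow (pairs n)"
    then have "finite E" by (auto intro: finite_subset)
    have "exp (\<Sum>e\<in>E. c e) = (\<Prod>e\<in>E. exp (c e))"
      using \<open>finite E\<close> by (rule exp_sum)
    also have "\<dots> = (\<Prod>e\<in>pairs n. if e \<in> E then exp (c e) else 1)"
      using E by (simp add: prod.If_cases Int_absorb1)
    finally have "sbm_weight n a b \<sigma> E * exp (\<Sum>e\<in>E. c e)
        = (\<Prod>e\<in>pairs n. (if e \<in> E then \<pi> e else 1 - \<pi> e) * (if e \<in> E then exp (c e) else 1))"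
      unfolding w by (simp only: prod.distrib)
    also have "\<dots> = (\<Prod>e\<in>pairs n. if e \<in> E then \<pi> e * exp (c e) else 1 - \<pi> e)"
      by (intro prod.cong) auto
    finally show "sbm_weight n a b \<sigma> E * exp ((\<Sum>e\<in>E. c e) - t)
        = exp (- t) * (\<Prod>e\<in>pairs n. if e \<in> E then \<pi> e * exp (c e) else 1 - \<pi> e)"
      by (simp add: exp_diff exp_minus field_simps)
  qed
  also have "\<dots> = exp (- t) * (\<Prod>e\<in>pairs n. \<pi> e * exp (c e) + (1 - \<pi> e))"
    by (simp add: sum_Pow_prod_choice)
  also have "\<dots> \<le> exp (- t) * (\<Prod>e\<in>pairs n. exp (\<pi> e * (exp (c e) - 1)))"
  proof (intro mult_left_mono prod_mono conjI)
    fix e assume "e \<in> pairs n"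
    have "0 \<le> \<pi> e" "\<pi> e \<le> 1" using r_nonneg r_le_1 by (auto simp: \<pi>_def)
    then show "0 \<le> \<pi> e * exp (c e) + (1 - \<pi> e)" by simp
    show "\<pi> e * exp (c e) + (1 - \<pi> e) \<le> exp (\<pi> e * (exp (c e) - 1))"
      using exp_ge_add_one_self[of "\<pi> e * (exp (c e) - 1)"] by (simp add: algebra_simps)
  qed auto
  also have "\<dots> = exp ((\<Sum>e\<in>pairs n. \<pi> e * (exp (c e) - 1)) - t)"
    by (simp add: exp_sum exp_diff exp_minus field_simps)
  finally show ?thesis by (simp add: \<pi>_def c_def case_prod_beta)
qed

text \<open>When the sets of a rectangle overlap, an edge may be counted twice. The inequality of
  arithmetic and geometric means decouples its two orientations at the price of doubling the
  exponent.\<close>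

lemma markov_rectangular:
  assumes "\<And>E. E \<subseteq> pairs n \<Longrightarrow> P (adj E) \<Longrightarrow> t \<le> (\<Sum>i<n. \<Sum>j<n. B i j * adj E i j)"
  shows "Pr P \<le> exp ((\<Sum>i<n. \<Sum>j<n. if i \<noteq> j then r i j * ((exp (2 * B i j) - 1) / 2) else 0) - t)"
proof -
  have "(\<Sum>(i, j)\<in>pairs n. r i j * (exp (B i j + B j i) - 1))
      \<le> (\<Sum>(i, j)\<in>pairs n. r i j * ((exp (2 * B i j) - 1) / 2) + r j i * ((exp (2 * B j i) - 1) / 2))"
  proof (intro sum_mono)
    fix e assume "e \<in> pairs n"
    obtain i j where e: "e = (i, j)" by force
    have "exp (B i j + B j i) \<le> (exp (2 * B i j) + exp (2 * B j i)) / 2"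
      using zero_le_power2[of "exp (B i j) - exp (B j i)"]
      by (simp add: power2_eq_square algebra_simps exp_add[symmetric])
    then have "r i j * (exp (B i j + B j i) - 1) \<le> r i j * ((exp (2 * B i j) - 1) / 2 + (exp (2 * B j i) - 1) / 2)"
      by (intro mult_left_mono r_nonneg) (simp add: field_simps)
    then show "(case e of (i, j) \<Rightarrow> r i j * (exp (B i j + B j i) - 1))
        \<le> (case e of (i, j) \<Rightarrow> r i j * ((exp (2 * B i j) - 1) / 2) + r j i * ((exp (2 * B j i) - 1) / 2))"
      unfolding e prod.case by (simp only: edge_prob_sym[of n a b \<sigma> j i] distrib_left)
  qed
  also have "\<dots> = (\<Sum>i<n. \<Sum>j<n. if i \<noteq> j then r i j * ((exp (2 * B i j) - 1) / 2) else 0)"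
    by (rule sum_pairs_symmetrize)
  finally have le: "(\<Sum>(i, j)\<in>pairs n. r i j * (exp (B i j + B j i) - 1)) \<le> \<dots>" .
  show ?thesis
    by (rule order.trans[OF exponential_markov[OF assms]]) (use le in auto)
qed

text \<open>With \<open>B\<close> supported on row \<open>i\<close>, at most one orientation of a
  pair has nonzero weight, so the doubling of \<open>markov_rectangular\<close> is avoided. The
  sharp exponent \<open>eta\<close> depends on this.\<close>

lemma markov_star:
  assumes i: "i < n"
    and P: "\<And>E. E \<subseteq> pairs n \<Longrightarrow> P (adj E) \<Longrightarrow> t \<le> (\<Sum>j<n. \<beta> j * adj E i j)"
  shows "Pr P \<le> exp ((\<Sum>j<n. if i \<noteq> j then r i j * (exp (\<beta> j) - 1) else 0) - t)"
proof -
  define B where "B = (\<lambda>k j. if k = i then \<beta> j else 0)"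
  have stat: "(\<Sum>k<n. \<Sum>j<n. B k j * adj E k j) = (\<Sum>j<n. \<beta> j * adj E i j)" for E
  proof -
    have "(\<Sum>k<n. \<Sum>j<n. B k j * adj E k j) = (\<Sum>k<n. if k = i then (\<Sum>j<n. \<beta> j * adj E k j) else 0)"
      by (intro sum.cong refl) (auto simp: B_def)
    then show ?thesis using i by simp
  qed
  have "(\<Sum>(k, j)\<in>pairs n. r k j * (exp (B k j + B j k) - 1))
      = (\<Sum>(k, j)\<in>pairs n. r k j * (exp (B k j) - 1) + r j k * (exp (B j k) - 1))"
  proof (intro sum.cong refl)
    fix e assume "e \<in> pairs n"
    then obtain k j where e: "e = (k, j)" and kj: "k \<noteq> j" by (force simp: pairs_def)
    have "exp (B k j + B j k) - 1 = (exp (B k j) - 1) + (exp (B j k) - 1)"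
      using kj by (auto simp: B_def)
    then show "(case e of (k, j) \<Rightarrow> r k j * (exp (B k j + B j k) - 1))
        = (case e of (k, j) \<Rightarrow> r k j * (exp (B k j) - 1) + r j k * (exp (B j k) - 1))"
      unfolding e prod.case by (simp only: edge_prob_sym[of n a b \<sigma> j k] distrib_left)
  qed
  also have "\<dots> = (\<Sum>k<n. \<Sum>j<n. if k \<noteq> j then r k j * (exp (B k j) - 1) else 0)"
    by (rule sum_pairs_symmetrize)
  also have "\<dots> = (\<Sum>k<n. if k = i then (\<Sum>j<n. if i \<noteq> j then r i j * (exp (\<beta> j) - 1) else 0) else 0)"
    by (intro sum.cong refl) (auto simp: B_def intro!: sum.cong sum.neutral)
  also have "\<dots> = (\<Sum>j<n. if i \<noteq> j then r i j * (exp (\<beta> j) - 1) else 0)"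
    using i by simp
  finally have eq: "(\<Sum>(k, j)\<in>pairs n. r k j * (exp (B k j + B j k) - 1)) = \<dots>" .
  show ?thesis
    using exponential_markov[of P t B] P unfolding stat eq by blast
qed

text \<open>Chernoff at exponent 1: since \<open>exp 1 - 1 \<le> 2\<close>, the mean costs at most
  \<open>2 * a * L\<close>, and the surplus 3 is the exponent of the tail.\<close>

lemma degree_tail:
  assumes "i < n"
  shows "Pr (\<lambda>A. (\<Sum>j<n. A i j) \<ge> (2 * a + 3) * ln (real n)) \<le> real n powr (-3)"
proof -
  define L where "L = ln (real n)"
  have L: "L \<ge> 0" using n_pos by (simp add: L_def)
  have e2: "exp 1 - 1 \<le> (2::real)" using exp_le by simp
  have "Pr (\<lambda>A. (\<Sum>j<n. A i j) \<ge> (2 * a + 3) * L)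
      \<le> exp ((\<Sum>j<n. if i \<noteq> j then r i j * (exp 1 - 1) else 0) - (2 * a + 3) * L)"
    by (rule markov_star[OF assms]) simp
  also have "(\<Sum>j<n. if i \<noteq> j then r i j * (exp 1 - 1) else 0) \<le> (\<Sum>j<n. a * L / real n * 2)"
  proof (rule sum_mono)
    fix j
    have "r i j * (exp 1 - 1) \<le> a * L / real n * 2"
      unfolding L_def by (intro mult_mono r_le e2) (use ab n_pos in auto)
    moreover have "0 \<le> a * L / real n * 2" using ab L by simp
    ultimately show "(if i \<noteq> j then r i j * (exp 1 - 1) else 0) \<le> a * L / real n * 2" by simp
  qed
  also have "(\<Sum>j<n. a * L / real n * 2) = 2 * a * L" using n_pos by simp
  finally have "Pr (\<lambda>A. (\<Sum>j<n. A i j) \<ge> (2 * a + 3) * L) \<le> exp (2 * a * L - (2 * a + 3) * L)"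
    by simp
  also have "\<dots> = real n powr (-3)"
    using n_pos by (simp add: powr_def L_def algebra_simps)
  finally show ?thesis unfolding L_def .
qed

end

section \<open>Discrepancy of the random graph\<close>

lemma sum_indicator_rect:
  fixes h :: "nat \<Rightarrow> nat \<Rightarrow> real"
  assumes "S \<subseteq> {..<n}" "T \<subseteq> {..<n}"
  shows "(\<Sum>i<n. \<Sum>j<n. if i \<in> S \<and> j \<in> T then h i j else 0) = (\<Sum>i\<in>S. \<Sum>j\<in>T. h i j)"
proof -
  have "(\<Sum>i\<in>S. \<Sum>j\<in>T. h i j) = (\<Sum>i<n. if i \<in> S then (\<Sum>j\<in>T. h i j) else 0)"
    using assms(1) by (simp add: sum.If_cases Int_absorb1)
  also have "\<dots> = (\<Sum>i<n. \<Sum>j<n. if i \<in> S \<and> j \<in> T then h i j else 0)"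
    using assms(2) by (intro sum.cong refl) (simp add: sum.If_cases Int_absorb1)
  finally show ?thesis ..
qed

lemma sum_power_card_Pow:
  fixes x :: real
  assumes "finite A"
  shows "(\<Sum>S\<in>Pow A. x ^ card S) = (1 + x) ^ card A"
  using prod_add[OF assms, of "\<lambda>_. x" "\<lambda>_. 1"] by (simp add: add.commute)

lemma exp_minus_le_quadratic:
  fixes x :: real
  assumes "x \<ge> 0"
  shows "exp (- x) \<le> 1 - x + x\<^sup>2"
proof -
  have "exp (- x) = 1 / exp x" by (simp add: exp_minus field_simps)
  also have "\<dots> \<le> 1 / (1 + x)" using assms by (intro divide_left_mono) auto
  also have "\<dots> \<le> 1 - x + x\<^sup>2"
  proof -
    have "1 \<le> (1 - x + x\<^sup>2) * (1 + x)"
      using assms by (simp add: power2_eq_square algebra_simps)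
    then show ?thesis using assms by (simp add: field_simps)
  qed
  finally show ?thesis .
qed

text \<open>The left side is the rate per expected edge in the rectangle bound after centring, with
  the sign \<open>\<epsilon>\<close> selecting the upper or lower tail. This version serves large
  \<open>\<theta>\<close>, the quadratic one small \<open>\<theta>\<close>.\<close>

lemma log_mgf_bound_crude:
  fixes \<theta> \<epsilon> :: real
  assumes "\<epsilon> = 1 \<or> \<epsilon> = -1" "\<theta> \<ge> 0"
  shows "(exp (2 * (\<epsilon> * \<theta>)) - 1) / 2 - \<epsilon> * \<theta> \<le> exp (2 * \<theta>) / 2"
proof -
  have 1: "1 + 2 * \<theta> \<le> exp (2 * \<theta>)" by (rule exp_ge_add_one_self)
  show ?thesis
  proof (cases "\<epsilon> = 1")
    case True
    then show ?thesis using assms(2) by (simp add: diff_divide_distrib)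
  next
    case False
    then have e: "\<epsilon> * \<theta> = - \<theta>" using assms(1) by auto
    have "(exp (2 * - \<theta>) - 1) / 2 \<le> 0" using assms by simp
    moreover have "\<theta> \<le> exp (2 * \<theta>) / 2" using 1 by linarith
    ultimately show ?thesis unfolding e by linarith
  qed
qed

lemma log_mgf_bound_quadratic:
  fixes \<theta> \<epsilon> :: real
  assumes "\<epsilon> = 1 \<or> \<epsilon> = -1" "\<theta> \<ge> 0" "\<theta> \<le> 1 / 2"
  shows "(exp (2 * (\<epsilon> * \<theta>)) - 1) / 2 - \<epsilon> * \<theta> \<le> 2 * \<theta>\<^sup>2"
proof -
  have "exp (2 * \<theta>) \<le> 1 + 2 * \<theta> + (2 * \<theta>)\<^sup>2" using assms by (intro exp_bound) auto
  moreover have "exp (- (2 * \<theta>)) \<le> 1 - 2 * \<theta> + (2 * \<theta>)\<^sup>2" using assms by (intro exp_minus_le_quadratic) auto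
  ultimately show ?thesis using assms by (auto simp: field_simps)
qed

context sbm
begin

text \<open>Centring is by the true expectation, which is zero on the diagonal. The block mean of
  the certificate differs from it there; \<open>failure_prob\<close> accounts for the
  difference.\<close>

definition dev :: "(nat \<Rightarrow> nat \<Rightarrow> real) \<Rightarrow> nat \<Rightarrow> nat \<Rightarrow> real" where
  "dev A i j = A i j - (if i \<noteq> j then r i j else 0)"

abbreviation "L \<equiv> ln (real n)"

lemma L_nonneg: "0 \<le> L"
  using n_pos by simp

text \<open>A constant weight \<open>\<epsilon> * \<theta>\<close> is put on the rectangle. Its
  expected sum \<open>Q\<close> cancels the linear part of the exponent, which leaves at most
  \<open>\<phi> * Q\<close>.\<close>

lemma rect_tail:
  assumes ST: "S \<subseteq> {..<n}" "T \<subseteq> {..<n}"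
    and \<phi>: "(exp (2 * (\<epsilon> * \<theta>)) - 1) / 2 - \<epsilon> * \<theta> \<le> \<phi>" "0 \<le> \<phi>" and \<theta>: "\<theta> \<ge> 0"
  shows "Pr (\<lambda>A. \<Delta> \<le> \<epsilon> * (\<Sum>i\<in>S. \<Sum>j\<in>T. dev A i j))
    \<le> exp (\<phi> * (a * L / real n * (real (card S) * real (card T))) - \<theta> * \<Delta>)"
proof -
  define Q where "Q = (\<Sum>i\<in>S. \<Sum>j\<in>T. if i \<noteq> j then r i j else 0)"
  define B where "B = (\<lambda>i j. if i \<in> S \<and> j \<in> T then \<epsilon> * \<theta> else 0)"
  have Q_le: "Q \<le> a * L / real n * (real (card S) * real (card T))"
  proof -
    have "0 \<le> a * L / real n" using ab L_nonneg by simp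
    then have "Q \<le> (\<Sum>i\<in>S. \<Sum>j\<in>T. a * L / real n)"
      unfolding Q_def using r_le by (intro sum_mono) auto
    then show ?thesis by (simp add: mult_ac)
  qed
  have stat: "(\<Sum>i<n. \<Sum>j<n. B i j * A i j) = \<theta> * (\<epsilon> * (\<Sum>i\<in>S. \<Sum>j\<in>T. dev A i j)) + \<epsilon> * \<theta> * Q" for A
  proof -
    have "(\<Sum>i<n. \<Sum>j<n. B i j * A i j) = (\<Sum>i<n. \<Sum>j<n. if i \<in> S \<and> j \<in> T then \<epsilon> * \<theta> * A i j else 0)"
      by (intro sum.cong refl) (simp add: B_def)
    also have "\<dots> = (\<Sum>i\<in>S. \<Sum>j\<in>T. \<epsilon> * \<theta> * A i j)" by (rule sum_indicator_rect[OF ST])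
    also have "\<dots> = \<epsilon> * \<theta> * (\<Sum>i\<in>S. \<Sum>j\<in>T. A i j)" by (simp only: sum_distrib_left)
    also have "(\<Sum>i\<in>S. \<Sum>j\<in>T. A i j) = (\<Sum>i\<in>S. \<Sum>j\<in>T. dev A i j) + Q"
      unfolding Q_def sum.distrib[symmetric] by (intro sum.cong refl) (simp add: dev_def)
    finally show ?thesis by (simp add: algebra_simps)
  qed
  have mgf: "(\<Sum>i<n. \<Sum>j<n. if i \<noteq> j then r i j * ((exp (2 * B i j) - 1) / 2) else 0)
      = (exp (2 * (\<epsilon> * \<theta>)) - 1) / 2 * Q"
  proof -
    have "(\<Sum>i<n. \<Sum>j<n. if i \<noteq> j then r i j * ((exp (2 * B i j) - 1) / 2) else 0)
        = (\<Sum>i<n. \<Sum>j<n. if i \<in> S \<and> j \<in> T then (exp (2 * (\<epsilon> * \<theta>)) - 1) / 2 * (if i \<noteq> j then r i j else 0) else 0)"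
      by (intro sum.cong refl) (simp add: B_def)
    also have "\<dots> = (exp (2 * (\<epsilon> * \<theta>)) - 1) / 2 * Q"
      unfolding sum_indicator_rect[OF ST] Q_def by (simp only: sum_distrib_left)
    finally show ?thesis .
  qed
  have Q0: "0 \<le> Q" unfolding Q_def using r_nonneg by (intro sum_nonneg) auto
  have "Pr (\<lambda>A. \<Delta> \<le> \<epsilon> * (\<Sum>i\<in>S. \<Sum>j\<in>T. dev A i j))
      \<le> exp ((\<Sum>i<n. \<Sum>j<n. if i \<noteq> j then r i j * ((exp (2 * B i j) - 1) / 2) else 0) - (\<theta> * \<Delta> + \<epsilon> * \<theta> * Q))"
    by (rule markov_rectangular) (unfold stat, use \<theta> in \<open>simp add: mult_left_mono\<close>)
  also have "\<dots> = exp (((exp (2 * (\<epsilon> * \<theta>)) - 1) / 2 - \<epsilon> * \<theta>) * Q - \<theta> * \<Delta>)"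
    unfolding mgf by (simp add: algebra_simps)
  also have "\<dots> \<le> exp (\<phi> * Q - \<theta> * \<Delta>)"
    using mult_right_mono[OF \<phi>(1) Q0] by simp
  also have "\<dots> \<le> exp (\<phi> * (a * L / real n * (real (card S) * real (card T))) - \<theta> * \<Delta>)"
    using mult_left_mono[OF Q_le \<phi>(2)] by simp
  finally show ?thesis .
qed

text \<open>Chernoff's bound is used with a large constant exponent for sets of size at most a constant
  fraction of \<open>n\<close>, where it must beat an entropy of order \<open>card T * ln n\<close>, and with a small constant
  exponent for linear-sized sets, where the entropy is only of order \<open>n\<close>.\<close>

lemma rect_tail_balanced:
  fixes \<delta> \<kappa> :: real
  defines "\<delta>' \<equiv> \<delta> * sqrt \<kappa>"
  defines "\<eta> \<equiv> 2 * exp (- (16 / \<delta>')) / a"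
  defines "\<theta> \<equiv> min (1 / 2) (\<delta>' / (4 * a))"
  assumes \<delta>: "\<delta> > 0" and \<kappa>: "\<kappa> > 0" and \<epsilon>: "\<epsilon> = 1 \<or> \<epsilon> = -1"
    and ST: "S \<subseteq> {..<n}" "T \<subseteq> {..<n}" "T \<noteq> {}" and le: "card S \<le> card T" and ge: "\<kappa> * real (card T) \<le> real (card S)"
  shows "Pr (\<lambda>A. \<delta> * L * sqrt (real (card S) * real (card T)) \<le> \<epsilon> * (\<Sum>i\<in>S. \<Sum>j\<in>T. dev A i j))
    \<le> 1 / real n * ((1 / real n ^ 3) ^ card S * (1 / real n ^ 3) ^ card T) + exp (- (\<theta> * \<delta>' * \<eta> / 2 * L * real n))"
    (is "?P \<le> ?x + ?y")
proof -
  define s t where "s = real (card S)" and "t = real (card T)"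
  have n: "real n > 0" using n_pos by simp
  have \<delta>': "\<delta>' > 0" using \<delta> \<kappa> by (simp add: \<delta>'_def)
  have \<eta>: "\<eta> > 0" using ab by (simp add: \<eta>_def)
  have \<theta>: "\<theta> > 0" "\<theta> \<le> 1 / 2" "\<theta> \<le> \<delta>' / (4 * a)" using \<delta>' ab by (auto simp: \<theta>_def)
  have t1: "card T \<ge> 1" using ST by (metis Suc_leI card_gt_0_iff finite_lessThan finite_subset One_nat_def)
  have st: "0 \<le> s" "s \<le> t" "1 \<le> t" using le t1 by (auto simp: s_def t_def)
  have tn: "t \<le> real n" using card_mono[OF finite_lessThan ST(2)] by (simp add: t_def)
  have sqrt_ge: "sqrt \<kappa> * t \<le> sqrt (s * t)"
  proof -
    have "sqrt \<kappa> * t = sqrt (\<kappa> * t * t)" using st by (simp add: real_sqrt_mult)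
    also have "\<dots> \<le> sqrt (s * t)" using ge st by (simp add: s_def t_def mult_right_mono)
    finally show ?thesis .
  qed
  define \<Delta> where "\<Delta> = \<delta> * L * sqrt (s * t)"
  have \<Delta>: "\<delta>' * L * t \<le> \<Delta>"
    using mult_left_mono[OF sqrt_ge, of "\<delta> * L"] \<delta> L_nonneg by (simp add: \<Delta>_def \<delta>'_def mult_ac)
  show ?thesis
  proof (cases "t \<le> \<eta> * real n")
    case True
    \<comment> \<open>This exponent turns the threshold into a gain of \<open>8 * L * t\<close>, and
      \<open>\<eta>\<close> is chosen so that \<open>exp (2 * \<Theta>)\<close> cancels and the mean
      costs at most \<open>L * t\<close>. The net gain is \<open>7 * L * t\<close>.\<close>
    define \<Theta> where "\<Theta> = 8 / \<delta>'"
    have \<Theta>: "\<Theta> \<ge> 0" using \<delta>' by (simp add: \<Theta>_def)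
    have "?P \<le> exp (exp (2 * \<Theta>) / 2 * (a * L / real n * (s * t)) - \<Theta> * \<Delta>)"
      unfolding s_def t_def \<Delta>_def by (rule rect_tail[OF ST(1,2) log_mgf_bound_crude[OF \<epsilon> \<Theta>] _ \<Theta>]) simp
    also have "\<dots> \<le> exp (L * t - 8 * (L * t))"
    proof -
      have "s * t \<le> t * (\<eta> * real n)" using True st mult_mono[of s t t "\<eta> * real n"] by simp
      then have "exp (2 * \<Theta>) / 2 * (a * L / real n * (s * t)) \<le> exp (2 * \<Theta>) / 2 * (a * L / real n * (t * (\<eta> * real n)))"
        using ab L_nonneg by (intro mult_left_mono) auto
      also have "\<dots> = (exp (2 * \<Theta>) * exp (- (16 / \<delta>'))) * (L * t)"
        using n ab by (simp add: \<eta>_def)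
      also have "exp (2 * \<Theta>) * exp (- (16 / \<delta>')) = 1"
        by (simp add: \<Theta>_def exp_add[symmetric])
      finally have 1: "exp (2 * \<Theta>) / 2 * (a * L / real n * (s * t)) \<le> L * t" by simp
      have "8 * (L * t) = \<Theta> * (\<delta>' * L * t)" using \<delta>' by (simp add: \<Theta>_def)
      also have "\<dots> \<le> \<Theta> * \<Delta>" using \<Delta> \<Theta> by (rule mult_left_mono)
      finally show ?thesis unfolding exp_le_cancel_iff using 1 by linarith
    qed
    also have "\<dots> = (1 / real n) ^ (7 * card T)"
    proof -
      have "L * t - 8 * (L * t) = real (7 * card T) * (- L)" by (simp add: t_def)
      moreover have "exp (- L) = 1 / real n" using n by (simp add: exp_minus field_simps)
      ultimately show ?thesis by (simp only: exp_of_nat_mult)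
    qed
    \<comment> \<open>As \<open>card S \<le> card T\<close> and \<open>card T \<ge> 1\<close>, the
      exponent 7 pays 3 per element of each set and leaves one factor \<open>1 / n\<close>.\<close>
    also have "\<dots> \<le> (1 / real n) ^ (1 + 3 * card S + 3 * card T)"
      using le t1 n_pos by (intro power_decreasing) auto
    also have "\<dots> = ?x" by (simp only: power_add power_mult power_one_over power_one_right mult.assoc)
    finally show ?thesis by (smt (verit) exp_gt_zero)
  next
    case False
    \<comment> \<open>\<open>\<theta> \<le> \<delta>' / (4 * a)\<close> keeps the quadratic term
      below half of the gain; \<open>t > \<eta> * n\<close> makes the other half linear in
      \<open>n\<close>.\<close>
    have "?P \<le> exp (2 * \<theta>\<^sup>2 * (a * L / real n * (s * t)) - \<theta> * \<Delta>)"
      unfolding s_def t_def \<Delta>_def using \<theta>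
      by (intro rect_tail[OF ST(1,2) log_mgf_bound_quadratic[OF \<epsilon>]]) auto
    also have "\<dots> \<le> exp (- (\<theta> * \<delta>' * \<eta> / 2 * L * real n))"
    proof -
      have "s * t \<le> t * real n" using tn st mult_mono[of s t t "real n"] by simp
      then have "2 * \<theta>\<^sup>2 * (a * L / real n * (s * t)) \<le> 2 * \<theta>\<^sup>2 * (a * L / real n * (t * real n))"
        using ab L_nonneg by (intro mult_left_mono) auto
      also have "\<dots> = (4 * a * \<theta>) * (\<theta> / 2 * (L * t))" using n by (simp add: power2_eq_square)
      also have "\<dots> \<le> \<delta>' * (\<theta> / 2 * (L * t))"
        using \<theta> ab L_nonneg st by (intro mult_right_mono) (auto simp: field_simps)
      finally have 1: "2 * \<theta>\<^sup>2 * (a * L / real n * (s * t)) \<le> \<theta> * \<delta>' / 2 * (L * t)" by (simp add: mult_ac)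
      have "\<theta> * (\<delta>' * L * t) \<le> \<theta> * \<Delta>" using \<Delta> \<theta> by (intro mult_left_mono) auto
      then have 2: "2 * (\<theta> * \<delta>' / 2 * (L * t)) \<le> \<theta> * \<Delta>" by (simp add: mult_ac)
      have "\<theta> * \<delta>' / 2 * L * (\<eta> * real n) \<le> \<theta> * \<delta>' / 2 * L * t"
        using False \<theta> \<delta>' L_nonneg by (intro mult_left_mono) auto
      then have 3: "\<theta> * \<delta>' * \<eta> / 2 * L * real n \<le> \<theta> * \<delta>' / 2 * (L * t)" by (simp add: mult_ac)
      show ?thesis unfolding exp_le_cancel_iff using 1 2 3 by linarith
    qed
    finally have "?P \<le> ?y" .
    moreover have "?x \<ge> 0" by simp
    ultimately show ?thesis by linarith
  qed
qed

text \<open>Only sets of comparable size are examined: \<open>discrepancy_all\<close> treats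
  unbalanced pairs by row sums, and \<open>card S \<le> card T\<close> may be arranged by
  symmetry.\<close>

definition irregular :: "real \<Rightarrow> real \<Rightarrow> (nat \<Rightarrow> nat \<Rightarrow> real) \<Rightarrow> bool" where
  "irregular \<delta> \<kappa> A \<longleftrightarrow> (\<exists>S T. S \<subseteq> {..<n} \<and> T \<subseteq> {..<n} \<and> T \<noteq> {} \<and> card S \<le> card T \<and>
     \<kappa> * real (card T) \<le> real (card S) \<and>
     \<delta> * L * sqrt (real (card S) * real (card T)) \<le> \<bar>\<Sum>i\<in>S. \<Sum>j\<in>T. dev A i j\<bar>)"

text \<open>Union bound over both sets and the sign. The factors \<open>z ^ card S\<close> and
  \<open>z ^ card T\<close> each sum to \<open>(1 + z) ^ n \<le> 3\<close>, which gives
  \<open>18 / n\<close>; the tail of large sets is multiplied by the number \<open>2 * 4 ^ n\<close>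
  of choices.\<close>

lemma irregular_prob:
  fixes \<delta> \<kappa> :: real
  defines "\<delta>' \<equiv> \<delta> * sqrt \<kappa>"
  defines "\<eta> \<equiv> 2 * exp (- (16 / \<delta>')) / a"
  defines "\<theta> \<equiv> min (1 / 2) (\<delta>' / (4 * a))"
  assumes \<delta>: "\<delta> > 0" and \<kappa>: "\<kappa> > 0"
  shows "Pr (irregular \<delta> \<kappa>) \<le> 18 / real n + 2 * 4 ^ n * exp (- (\<theta> * \<delta>' * \<eta> / 2 * L * real n))"
proof -
  let ?V = "Pow {..<n}"
  define y where "y = exp (- (\<theta> * \<delta>' * \<eta> / 2 * L * real n))"
  define z where "z = 1 / real n ^ 3"
  define ok where "ok = (\<lambda>(S::nat set) (T::nat set). T \<noteq> {} \<and> card S \<le> card T \<and> \<kappa> * real (card T) \<le> real (card S))"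
  define ev where "ev = (\<lambda>S T \<epsilon> A. ok S T \<and>
     \<delta> * L * sqrt (real (card S) * real (card T)) \<le> \<epsilon> * (\<Sum>i\<in>S. \<Sum>j\<in>T. dev A i j))"
  have n: "real n \<ge> 1" using n_pos by simp
  have z0: "z \<ge> 0" by (simp add: z_def)
  have "Pr (irregular \<delta> \<kappa>) \<le> Pr (\<lambda>A. \<exists>(S, T, \<epsilon>)\<in>?V \<times> ?V \<times> {1, -1}. ev S T \<epsilon> A)"
  proof (rule Pr_mono)
    fix E assume "irregular \<delta> \<kappa> (adj E)"
    then obtain S T where ST: "S \<in> ?V" "T \<in> ?V" "ok S T"
        "\<delta> * L * sqrt (real (card S) * real (card T)) \<le> \<bar>\<Sum>i\<in>S. \<Sum>j\<in>T. dev (adj E) i j\<bar>"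
      unfolding irregular_def ok_def by blast
    then have "ev S T 1 (adj E) \<or> ev S T (-1) (adj E)"
      by (auto simp: ev_def abs_if split: if_splits)
    then show "\<exists>(S, T, \<epsilon>)\<in>?V \<times> ?V \<times> {1, -1}. ev S T \<epsilon> (adj E)"
      using ST by blast
  qed
  also have "\<dots> \<le> (\<Sum>(S, T, \<epsilon>)\<in>?V \<times> ?V \<times> {1, -1}. Pr (ev S T \<epsilon>))"
    using Pr_union[of "?V \<times> ?V \<times> {1, -1}" "\<lambda>(S, T, \<epsilon>). ev S T \<epsilon>"] by (simp add: case_prod_beta)
  also have "\<dots> \<le> (\<Sum>(S, T, \<epsilon>)\<in>?V \<times> ?V \<times> {1, -1::real}. 1 / real n * (z ^ card S * z ^ card T) + y)"
  proof (intro sum_mono)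
    fix w assume "w \<in> ?V \<times> ?V \<times> {1, -1::real}"
    then obtain S T \<epsilon> where w: "w = (S, T, \<epsilon>)" and ST: "S \<subseteq> {..<n}" "T \<subseteq> {..<n}" and \<epsilon>: "\<epsilon> = 1 \<or> \<epsilon> = -1"
      by auto
    have "Pr (ev S T \<epsilon>) \<le> 1 / real n * (z ^ card S * z ^ card T) + y"
    proof (cases "ok S T")
      case True
      then have "Pr (ev S T \<epsilon>) = Pr (\<lambda>A. \<delta> * L * sqrt (real (card S) * real (card T)) \<le> \<epsilon> * (\<Sum>i\<in>S. \<Sum>j\<in>T. dev A i j))"
        by (simp add: ev_def)
      also have "\<dots> \<le> 1 / real n * (z ^ card S * z ^ card T) + y"
        unfolding z_def y_def \<theta>_def \<eta>_def \<delta>'_def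
        using True by (intro rect_tail_balanced \<delta> \<kappa> \<epsilon> ST) (auto simp: ok_def)
      finally show ?thesis .
    next
      case False
      then have "Pr (ev S T \<epsilon>) = 0" by (simp add: ev_def Pr_False)
      then show ?thesis using z0 by (simp add: y_def)
    qed
    then show "(case w of (S, T, \<epsilon>) \<Rightarrow> Pr (ev S T \<epsilon>)) \<le> (case w of (S, T, \<epsilon>) \<Rightarrow> 1 / real n * (z ^ card S * z ^ card T) + y)"
      by (simp add: w)
  qed
  also have "\<dots> = (\<Sum>S\<in>?V. \<Sum>T\<in>?V. \<Sum>\<epsilon>\<in>{1, -1::real}. 1 / real n * (z ^ card S * z ^ card T) + y)"
    by (simp only: sum.cartesian_product[symmetric])
  also have "\<dots> = (\<Sum>S\<in>?V. \<Sum>T\<in>?V. 2 / real n * (z ^ card S * z ^ card T) + 2 * y)"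
    by (intro sum.cong refl) simp
  also have "\<dots> = 2 / real n * ((\<Sum>S\<in>?V. z ^ card S) * (\<Sum>T\<in>?V. z ^ card T)) + (\<Sum>S\<in>?V. \<Sum>T\<in>?V. 2 * y)"
    unfolding sum_product by (simp only: sum.distrib sum_distrib_left)
  also have "(\<Sum>S\<in>?V. z ^ card S) = (1 + z) ^ n"
    using sum_power_card_Pow[of "{..<n}" z] by simp
  also have "(\<Sum>S\<in>?V. \<Sum>T\<in>?V. 2 * y) = 2 * 4 ^ n * y"
    by (simp add: card_Pow power_mult_distrib[symmetric])
  also have "2 / real n * ((1 + z) ^ n * (1 + z) ^ n) \<le> 2 / real n * (3 * 3)"
  proof -
    have "(1 + z) ^ n \<le> exp z ^ n"
      using z0 exp_ge_add_one_self[of z] by (intro power_mono) auto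
    also have "\<dots> = exp (real n * z)" by (simp add: exp_of_nat_mult)
    also have "\<dots> \<le> exp 1"
    proof -
      have "real n * z = 1 / real n ^ 2" using n by (simp add: z_def power2_eq_square power3_eq_cube)
      also have "\<dots> \<le> 1" using n by (simp add: field_simps)
      finally show ?thesis by simp
    qed
    also have "\<dots> \<le> 3" by (rule exp_le)
    finally have "(1 + z) ^ n \<le> 3" .
    then show ?thesis using z0 n by (intro mult_left_mono mult_mono) auto
  qed
  finally show ?thesis by (simp add: y_def)
qed

lemma dev_sym: "dev (adj E) i j = dev (adj E) j i"
  by (simp add: dev_def adj_sym[of E i j] edge_prob_sym[of n a b \<sigma> i j])

lemma dev_row_sum:
  assumes "i < n" "(\<Sum>j<n. adj E i j) \<le> (2 * a + 3) * L"
  shows "(\<Sum>j<n. \<bar>dev (adj E) i j\<bar>) \<le> (3 * a + 3) * L"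
proof -
  have "(\<Sum>j<n. \<bar>dev (adj E) i j\<bar>) \<le> (\<Sum>j<n. adj E i j + a * L / real n)"
  proof (rule sum_mono)
    fix j
    have "0 \<le> a * L / real n" using ab L_nonneg by simp
    moreover have "0 \<le> adj E i j" by (simp add: adj_def)
    ultimately show "\<bar>dev (adj E) i j\<bar> \<le> adj E i j + a * L / real n"
      using r_nonneg[of i j] r_le[of i j] by (auto simp: dev_def abs_if)
  qed
  also have "\<dots> = (\<Sum>j<n. adj E i j) + a * L" using n_pos by (simp add: sum.distrib)
  finally show ?thesis using assms(2) by (simp add: algebra_simps)
qed

text \<open>\<kappa> is the threshold at which row sums take over: if
  \<open>card S < \<kappa> * card T\<close>, then \<open>(3 * a + 3) * L * card S\<close> is already
  below the required bound.\<close>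

lemma discrepancy_all:
  assumes \<delta>: "\<delta> > 0" and reg: "\<not> irregular \<delta> ((\<delta> / (3 * a + 3))\<^sup>2) (adj E)"
    and deg: "\<And>i. i < n \<Longrightarrow> (\<Sum>j<n. adj E i j) \<le> (2 * a + 3) * L"
    and ST: "S \<subseteq> {..<n}" "T \<subseteq> {..<n}"
  shows "\<bar>\<Sum>i\<in>S. \<Sum>j\<in>T. dev (adj E) i j\<bar> \<le> \<delta> * L * sqrt (real (card S) * real (card T))"
proof -
  define \<kappa> where "\<kappa> = (\<delta> / (3 * a + 3))\<^sup>2"
  have main: "\<bar>\<Sum>i\<in>S. \<Sum>j\<in>T. dev (adj E) i j\<bar> \<le> \<delta> * L * sqrt (real (card S) * real (card T))"
    if ST: "S \<subseteq> {..<n}" "T \<subseteq> {..<n}" and le: "card S \<le> card T" for S T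
  proof (cases "T = {} \<or> \<kappa> * real (card T) \<le> real (card S)")
    case True
    show ?thesis
    proof (cases "T = {}")
      case False
      then have "\<not> \<delta> * L * sqrt (real (card S) * real (card T)) \<le> \<bar>\<Sum>i\<in>S. \<Sum>j\<in>T. dev (adj E) i j\<bar>"
        using reg ST le True unfolding irregular_def \<kappa>_def by blast
      then show ?thesis by linarith
    qed simp
  next
    case False
    have "\<bar>\<Sum>i\<in>S. \<Sum>j\<in>T. dev (adj E) i j\<bar> \<le> (3 * a + 3) * L * real (card S)"
      using dev_row_sum deg ST by (intro rect_sum_le_rows[where n = n]) auto
    also have "real (card S) = sqrt (real (card S)) * sqrt (real (card S))" by simp
    also have "(3 * a + 3) * L * (sqrt (real (card S)) * sqrt (real (card S)))
        \<le> (3 * a + 3) * L * (sqrt (real (card S)) * sqrt (\<kappa> * real (card T)))"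
      using False ab L_nonneg by (intro mult_left_mono) auto
    also have "sqrt (\<kappa> * real (card T)) = \<delta> / (3 * a + 3) * sqrt (real (card T))"
      using \<delta> ab by (simp add: \<kappa>_def real_sqrt_mult)
    also have "(3 * a + 3) * L * (sqrt (real (card S)) * (\<delta> / (3 * a + 3) * sqrt (real (card T))))
        = \<delta> * L * sqrt (real (card S) * real (card T))"
      using ab by (simp add: real_sqrt_mult field_simps)
    finally show ?thesis .
  qed
  show ?thesis
  proof (cases "card S \<le> card T")
    case True
    then show ?thesis by (rule main[OF ST])
  next
    case False
    have "(\<Sum>i\<in>S. \<Sum>j\<in>T. dev (adj E) i j) = (\<Sum>j\<in>T. \<Sum>i\<in>S. dev (adj E) i j)" by (rule sum.swap)
    also have "\<dots> = (\<Sum>j\<in>T. \<Sum>i\<in>S. dev (adj E) j i)"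
      by (intro sum.cong refl dev_sym)
    finally show ?thesis using main[OF ST(2,1)] False by (simp add: mult.commute)
  qed
qed

lemma dev_bilinear_bound:
  assumes \<delta>: "\<delta> > 0" and reg: "\<not> irregular \<delta> ((\<delta> / (3 * a + 3))\<^sup>2) (adj E)"
    and deg: "\<And>i. i < n \<Longrightarrow> (\<Sum>j<n. adj E i j) \<le> (2 * a + 3) * L"
  shows "\<bar>\<Sum>i<n. \<Sum>j<n. x i * dev (adj E) i j * y j\<bar>
    \<le> (\<delta> * (2 * real k + 1) + 2 * (3 * a + 3) / 2 ^ k) * L * ((\<Sum>i<n. (x i)\<^sup>2) + (\<Sum>i<n. (y i)\<^sup>2))"
proof -
  have row: "(\<Sum>j<n. \<bar>dev (adj E) i j\<bar>) \<le> (3 * a + 3) * L" if "i < n" for i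
    using dev_row_sum deg that by blast
  have col: "(\<Sum>i<n. \<bar>dev (adj E) i j\<bar>) \<le> (3 * a + 3) * L" if "j < n" for j
    using row[OF that] by (simp add: dev_sym[of E _ j])
  have "\<bar>\<Sum>i<n. \<Sum>j<n. x i * dev (adj E) i j * y j\<bar>
      \<le> 2 * (\<delta> * L * (2 * real k + 1) / 2 + (3 * a + 3) * L / 2 ^ k) * ((\<Sum>i<n. (x i)\<^sup>2) + (\<Sum>i<n. (y i)\<^sup>2))"
    by (rule bilinear_bound) (use \<delta> ab L_nonneg row col discrepancy_all[OF \<delta> reg deg] in auto)
  also have "2 * (\<delta> * L * (2 * real k + 1) / 2 + (3 * a + 3) * L / 2 ^ k) = (\<delta> * (2 * real k + 1) + 2 * (3 * a + 3) / 2 ^ k) * L"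
    by (simp add: field_simps)
  finally show ?thesis .
qed

end

section \<open>The exponent eta and the diagonal of the certificate\<close>

text \<open>\<open>sbm_tau a b\<close> is the logarithmic mean of \<open>a\<close> and
  \<open>b\<close>. Both bounds are instances of \<open>ln x < x - 1\<close>, at
  \<open>a / b\<close> and at \<open>b / a\<close>.\<close>

lemma sbm_tau_bounds:
  assumes "0 < b" "b < a"
  shows "b < sbm_tau a b" "sbm_tau a b < a"
proof -
  have lt: "ln x < x - 1" if "0 < x" "x \<noteq> 1" for x :: real
    using ln_le_minus_one[OF that(1)] ln_eq_minus_one[OF that(1)] that(2) by linarith
  have D: "ln a - ln b > 0" using assms by simp
  have "ln a - ln b = ln (a / b)" using assms by (simp add: ln_div)
  also have "\<dots> < a / b - 1" using assms by (intro lt) auto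
  finally have "b * (ln a - ln b) < a - b" using assms by (simp add: field_simps)
  then show "b < sbm_tau a b" using D by (simp add: sbm_tau_def field_simps)
  have "ln b - ln a = ln (b / a)" using assms by (simp add: ln_div)
  also have "\<dots> < b / a - 1" using assms by (intro lt) auto
  finally have "a - b < a * (ln a - ln b)" using assms by (simp add: field_simps)
  then show "sbm_tau a b < a" using D by (simp add: sbm_tau_def field_simps)
qed

text \<open>\<open>eta\<close> is the common value of the two Chernoff exponents, one per cluster; the optimisers
  are the logarithms of the positive root \<open>z\<close> of a quadratic equation and of \<open>a / (b * z)\<close>.\<close>

lemma eta_chernoff:
  fixes a b \<rho> :: real
  assumes ab: "0 < b" "b < a" and \<rho>: "0 < \<rho>" "\<rho> \<le> 1 / 2"
  obtains \<theta> \<theta>' where "0 \<le> \<theta>" "0 \<le> \<theta>'" "\<theta> + \<theta>' = ln a - ln b"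
    "- sbm_tau a b * (1 - 2 * \<rho>) * \<theta> + a * \<rho> * (exp (- \<theta>) - 1) + b * (1 - \<rho>) * (exp \<theta> - 1) = - eta \<rho> a b"
    "sbm_tau a b * (1 - 2 * \<rho>) * \<theta>' + a * (1 - \<rho>) * (exp (- \<theta>') - 1) + b * \<rho> * (exp \<theta>' - 1) = - eta \<rho> a b"
proof -
  define \<tau> where "\<tau> = sbm_tau a b"
  define \<gamma> where "\<gamma> = sbm_gamma \<rho> a b"
  define d where "d = 1 - 2 * \<rho>"
  define B where "B = b * (1 - \<rho>)"
  have \<tau>: "b < \<tau>" "\<tau> < a" using sbm_tau_bounds[OF ab] by (simp_all add: \<tau>_def)
  have d: "0 \<le> d" using \<rho> by (simp add: d_def)
  have B: "B > 0" using ab \<rho> by (simp add: B_def)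
  have ar: "a * \<rho> > 0" using ab \<rho> by simp
  have g2: "\<gamma> * \<gamma> = d * \<tau> * (d * \<tau>) + 4 * B * (a * \<rho>)"
  proof -
    have "0 \<le> ((1 - \<rho>) - \<rho>)\<^sup>2 * \<tau>\<^sup>2 + 4 * \<rho> * (1 - \<rho>) * a * b" using ab \<rho> by simp
    then have "\<gamma> * \<gamma> = ((1 - \<rho>) - \<rho>)\<^sup>2 * \<tau>\<^sup>2 + 4 * \<rho> * (1 - \<rho>) * a * b"
      by (simp add: \<gamma>_def sbm_gamma_def \<tau>_def)
    then show ?thesis by (simp add: d_def B_def power2_eq_square algebra_simps)
  qed
  have g0: "\<gamma> \<ge> 0" by (simp add: \<gamma>_def sbm_gamma_def \<tau>_def[symmetric]) (use ab \<rho> in simp)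
  have "d * \<tau> \<ge> 0" using d \<tau> ab by simp
  have "\<gamma> > 0" using g2 g0 B ar \<open>d * \<tau> \<ge> 0\<close>
    by (metis add_nonneg_pos less_eq_real_def mult_nonneg_nonneg mult_pos_pos mult_zero_left not_less_iff_gr_or_eq zero_less_numeral)
  \<comment> \<open>Setting the derivative of the first Chernoff exponent to zero gives
    \<open>root\<close> for \<open>z = exp \<theta>\<close>; this is its positive solution.\<close>
  define z where "z = (\<gamma> + d * \<tau>) / (2 * B)"
  have z: "z > 0" using \<open>\<gamma> > 0\<close> \<open>d * \<tau> \<ge> 0\<close> B by (simp add: z_def)
  have z1: "\<gamma> + d * \<tau> = 2 * B * z" using B by (simp add: z_def)
  have root: "B * z = d * \<tau> + a * \<rho> / z"
  proof -
    have "4 * B * (B * z * z) = (2 * B * z) * (2 * B * z)" by simp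
    also have "\<dots> = \<gamma> * \<gamma> + 2 * \<gamma> * (d * \<tau>) + d * \<tau> * (d * \<tau>)"
      unfolding z1[symmetric] by (simp add: algebra_simps)
    also have "\<dots> = 2 * (d * \<tau>) * (\<gamma> + d * \<tau>) + 4 * B * (a * \<rho>)"
      unfolding g2 by (simp add: algebra_simps)
    also have "\<dots> = 4 * B * (d * \<tau> * z + a * \<rho>)" unfolding z1 by (simp add: algebra_simps)
    finally have "B * z * z = d * \<tau> * z + a * \<rho>" using B by simp
    then show ?thesis using z by (simp add: field_simps)
  qed
  have z2: "\<gamma> - d * \<tau> = 2 * (a * \<rho>) / z"
  proof -
    have "2 * (a * \<rho>) / z = 2 * (a * \<rho> / z)" by simp
    then show ?thesis using root z1 by linarith
  qed
  \<comment> \<open>The bounds \<open>b < \<tau> < a\<close> confine the root to the interval from 1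
    to \<open>a / b\<close>, so \<open>\<theta>\<close> and \<open>\<theta>'\<close> are nonnegative
    as Chernoff's bound requires.\<close>
  have "z \<ge> 1"
  proof (rule ccontr)
    assume "\<not> z \<ge> 1"
    then have "a * \<rho> < a * \<rho> / z"
      using z mult_strict_left_mono[OF _ ar, of z 1] by (simp add: less_divide_eq)
    moreover have "d * b \<le> d * \<tau>" "b * \<rho> \<le> a * \<rho>" using d \<tau> ab \<rho> by (auto intro: mult_left_mono)
    moreover have "B = d * b + b * \<rho>" by (simp add: B_def d_def algebra_simps)
    moreover have "B * z \<le> B * 1" using \<open>\<not> z \<ge> 1\<close> B by (intro mult_left_mono) auto
    ultimately show False using root by linarith
  qed
  have "z \<le> a / b"
  proof (rule ccontr)
    assume "\<not> z \<le> a / b"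
    then have "a * \<rho> / z \<le> a * \<rho> / (a / b)" using ar ab z by (intro divide_left_mono) auto
    then have "a * \<rho> / z \<le> b * \<rho>" using ab by (simp add: mult.commute)
    moreover have "d * \<tau> \<le> d * a" "b * \<rho> \<le> a * \<rho>" using d \<tau> ab \<rho> by (auto intro: mult_left_mono)
    moreover have "d * a + a * \<rho> = B * (a / b)" using ab by (simp add: B_def d_def algebra_simps)
    moreover have "B * (a / b) < B * z" using \<open>\<not> z \<le> a / b\<close> B by (intro mult_strict_left_mono) auto
    ultimately show False using root by linarith
  qed
  define \<theta> where "\<theta> = ln z"
  define \<theta>' where "\<theta>' = ln a - ln b - ln z"
  have \<tau>_ln: "\<tau> * (ln a - ln b) = a - b" using ab by (simp add: \<tau>_def sbm_tau_def)
  define V where "V = - (d * \<tau> * \<theta>) + \<gamma> - a * \<rho> - B"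
  have eta: "eta \<rho> a b = - V"
  proof -
    have "\<rho> * (\<gamma> + d * \<tau>) / ((1 - \<rho>) * (\<gamma> - d * \<tau>)) = b * z * z / a"
      unfolding z1 z2 B_def using \<rho> ab z by (simp add: field_simps)
    then have ln_eq: "ln (\<rho> * (\<gamma> + d * \<tau>) / ((1 - \<rho>) * (\<gamma> - d * \<tau>))) = ln b + 2 * \<theta> - ln a"
      using ab z by (simp add: ln_mult ln_div \<theta>_def)
    have eta_eq: "eta \<rho> a b = (a + b) / 2 - \<gamma> + d * \<tau> / 2 * ln (\<rho> * (\<gamma> + d * \<tau>) / ((1 - \<rho>) * (\<gamma> - d * \<tau>)))"
      using \<rho> by (simp add: eta_def Let_def \<tau>_def \<gamma>_def d_def)
    have "eta \<rho> a b = (a + b) / 2 - \<gamma> + d * \<tau> * \<theta> - d / 2 * (\<tau> * (ln a - ln b))"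
      unfolding eta_eq ln_eq by (simp add: field_simps)
    then show ?thesis unfolding \<tau>_ln V_def B_def d_def by (simp add: field_simps)
  qed
  have V: "V = - (d * \<tau> * \<theta>) + B * z + a * \<rho> / z - a * \<rho> - B"
    unfolding V_def using z1 root by linarith
  have e: "exp \<theta> = z" "exp (- \<theta>) = 1 / z" using z by (simp_all add: \<theta>_def exp_minus field_simps)
  have e': "exp \<theta>' = a / (b * z)" "exp (- \<theta>') = b * z / a"
    using z ab by (simp_all add: \<theta>'_def exp_diff exp_add exp_minus field_simps)
  show ?thesis
  proof (rule that)
    show "0 \<le> \<theta>" using \<open>z \<ge> 1\<close> by (simp add: \<theta>_def)
    have "ln z \<le> ln (a / b)" using \<open>z \<le> a / b\<close> z ab by (subst ln_le_cancel_iff) auto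
    then show "0 \<le> \<theta>'" using ab by (simp add: \<theta>'_def ln_div)
    show "\<theta> + \<theta>' = ln a - ln b" by (simp add: \<theta>_def \<theta>'_def)
    show "- sbm_tau a b * (1 - 2 * \<rho>) * \<theta> + a * \<rho> * (exp (- \<theta>) - 1) + b * (1 - \<rho>) * (exp \<theta> - 1) = - eta \<rho> a b"
      unfolding eta e \<tau>_def[symmetric] d_def[symmetric] B_def[symmetric]
      by (simp add: V algebra_simps)
    \<comment> \<open>Passing from \<open>\<theta>\<close> to \<open>\<theta>'\<close> exchanges the
      two exponential terms, and \<open>\<tau> * (ln a - ln b) = a - b\<close> matches the
      constants. Thus this \<tau> equalises the exponents of the clusters.\<close>
    have "\<tau> * d * \<theta>' = d * (a - b) - d * \<tau> * \<theta>"
      unfolding \<tau>_ln[symmetric] by (simp add: \<theta>'_def \<theta>_def algebra_simps)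
    moreover have "a * (1 - \<rho>) * (b * z / a - 1) = B * z - a * (1 - \<rho>)"
      using ab by (simp add: B_def field_simps)
    moreover have "b * \<rho> * (a / (b * z) - 1) = a * \<rho> / z - b * \<rho>"
      using ab z by (simp add: field_simps)
    ultimately show "sbm_tau a b * (1 - 2 * \<rho>) * \<theta>' + a * (1 - \<rho>) * (exp (- \<theta>') - 1) + b * \<rho> * (exp \<theta>' - 1) = - eta \<rho> a b"
      unfolding eta e' \<tau>_def[symmetric] d_def[symmetric]
      by (simp add: V) (simp add: B_def d_def algebra_simps)
  qed
qed

context sbm
begin

section \<open>Lower tail of the diagonal entries\<close>

text \<open>\<open>(n + \<sigma> i * m) / 2\<close> is the size of the cluster of \<open>i\<close>;
  its members contribute \<open>h1\<close> each and the other vertices \<open>h2\<close>. The term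
  \<open>- h1\<close> removes \<open>i\<close> itself, which is not its own neighbour.\<close>

lemma degree_gap_tail:
  fixes \<theta> m h1 h2 c x :: real and K :: nat
  defines "m \<equiv> 2 * real K - real n"
  defines "h1 \<equiv> a * L / real n * (exp (- \<theta>) - 1)" and "h2 \<equiv> b * L / real n * (exp \<theta> - 1)"
  assumes lab: "\<sigma> \<in> labelings n K" and i: "i < n" and \<theta>: "0 \<le> \<theta>"
  shows "Pr (\<lambda>A. (\<Sum>j<n. A i j * real_of_int (\<sigma> i * \<sigma> j)) - c * real_of_int (\<sigma> i) < x)
    \<le> exp ((real n + \<sigma> i * m) / 2 * h1 + (real n - \<sigma> i * m) / 2 * h2 - h1 + \<theta> * (x + c * \<sigma> i))"
proof -
  have sg: "\<sigma> j = 1 \<or> \<sigma> j = -1" if "j < n" for j using lab that by (simp add: labelings_def)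
  have "Pr (\<lambda>A. (\<Sum>j<n. A i j * real_of_int (\<sigma> i * \<sigma> j)) - c * real_of_int (\<sigma> i) < x)
      \<le> exp ((\<Sum>j<n. if i \<noteq> j then r i j * (exp (- \<theta> * real_of_int (\<sigma> i * \<sigma> j)) - 1) else 0) - (- \<theta> * (x + c * \<sigma> i)))"
  proof (rule markov_star[OF i])
    fix E assume "(\<Sum>j<n. adj E i j * real_of_int (\<sigma> i * \<sigma> j)) - c * real_of_int (\<sigma> i) < x"
    then have "\<theta> * (\<Sum>j<n. adj E i j * real_of_int (\<sigma> i * \<sigma> j)) \<le> \<theta> * (x + c * \<sigma> i)"
      using \<theta> by (intro mult_left_mono) auto
    moreover have "(\<Sum>j<n. - \<theta> * real_of_int (\<sigma> i * \<sigma> j) * adj E i j) = - (\<theta> * (\<Sum>j<n. adj E i j * real_of_int (\<sigma> i * \<sigma> j)))"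
      by (simp add: sum_distrib_left sum_negf[symmetric] mult_ac)
    ultimately show "- \<theta> * (x + c * \<sigma> i) \<le> (\<Sum>j<n. - \<theta> * real_of_int (\<sigma> i * \<sigma> j) * adj E i j)" by linarith
  qed
  also have "(\<Sum>j<n. if i \<noteq> j then r i j * (exp (- \<theta> * real_of_int (\<sigma> i * \<sigma> j)) - 1) else 0)
      = (\<Sum>j<n. ((h1 + h2) / 2 + (h1 - h2) / 2 * \<sigma> i * \<sigma> j) - (if j = i then h1 else 0))"
  proof (intro sum.cong refl)
    fix j assume "j \<in> {..<n}"
    then have j: "j < n" by simp
    show "(if i \<noteq> j then r i j * (exp (- \<theta> * real_of_int (\<sigma> i * \<sigma> j)) - 1) else 0)
      = ((h1 + h2) / 2 + (h1 - h2) / 2 * \<sigma> i * \<sigma> j) - (if j = i then h1 else 0)"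
    proof (cases "j = i")
      case True
      then show ?thesis using sg[OF i] by (auto simp: field_simps)
    next
      case False
      have "r i j * (exp (- \<theta> * real_of_int (\<sigma> i * \<sigma> j)) - 1) = (if \<sigma> i = \<sigma> j then h1 else h2)"
        using sg[OF i] sg[OF j] by (auto simp: edge_prob_def h1_def h2_def)
      also have "\<dots> = (h1 + h2) / 2 + (h1 - h2) / 2 * \<sigma> i * \<sigma> j"
        using sg[OF i] sg[OF j] by (auto simp: field_simps)
      finally show ?thesis using False by simp
    qed
  qed
  also have "\<dots> = (h1 + h2) / 2 * real n + (h1 - h2) / 2 * \<sigma> i * m - h1"
    unfolding sum_subtractf sum_sign_affine[OF labelings_sum[OF lab]] using i by (simp add: m_def)
  also have "\<dots> - (- \<theta> * (x + c * \<sigma> i)) = (real n + \<sigma> i * m) / 2 * h1 + (real n - \<sigma> i * m) / 2 * h2 - h1 + \<theta> * (x + c * \<sigma> i)"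
    by (simp add: field_simps)
  finally show ?thesis .
qed

text \<open>\<open>eta_chernoff\<close> provides the exponent for each cluster. Rounding
  \<open>K\<close> and removing \<open>i\<close> change it by a constant times \<open>L / n\<close>,
  absorbed in \<open>5 * a\<close>. Raising the threshold from 0 to \<open>\<epsilon> * L\<close>
  costs at most \<open>(ln a - ln b) * \<epsilon> * L\<close>.\<close>

lemma degree_gap_prob:
  fixes \<rho> \<epsilon> lam :: real and K :: nat
  defines "lam \<equiv> sbm_tau a b * L / real n"
  assumes lab: "\<sigma> \<in> labelings n K" and i: "i < n"
    and \<rho>: "0 < \<rho>" "\<rho> \<le> 1 / 2" and K: "\<rho> * real n \<le> real K" "real K \<le> \<rho> * real n + 1" and \<epsilon>: "0 \<le> \<epsilon>"
  shows "Pr (\<lambda>A. (\<Sum>j<n. A i j * real_of_int (\<sigma> i * \<sigma> j)) - lam * (2 * real K - real n) * real_of_int (\<sigma> i) < \<epsilon> * L)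
    \<le> exp (5 * a - (eta \<rho> a b - (ln a - ln b) * \<epsilon>) * L)"
proof -
  obtain \<theta> \<theta>' where \<theta>: "0 \<le> \<theta>" "0 \<le> \<theta>'" "\<theta> + \<theta>' = ln a - ln b"
    and F1: "- sbm_tau a b * (1 - 2 * \<rho>) * \<theta> + a * \<rho> * (exp (- \<theta>) - 1) + b * (1 - \<rho>) * (exp \<theta> - 1) = - eta \<rho> a b"
    and F2: "sbm_tau a b * (1 - 2 * \<rho>) * \<theta>' + a * (1 - \<rho>) * (exp (- \<theta>') - 1) + b * \<rho> * (exp \<theta>' - 1) = - eta \<rho> a b"
    by (rule eta_chernoff[OF ab \<rho>])
  define \<tau> where "\<tau> = sbm_tau a b"
  define N where "N = real n"
  define k where "k = real K"
  define l where "l = L / N"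
  have N: "N \<ge> 1" using n_pos by (simp add: N_def)
  have l: "0 \<le> l" "l \<le> 1" "l * N = L"
  proof -
    show "0 \<le> l" using N L_nonneg by (simp add: l_def)
    have "L \<le> N" using ln_bound[of N] N by (simp add: N_def)
    then show "l \<le> 1" using N by (simp add: l_def)
    show "l * N = L" using N by (simp add: l_def)
  qed
  have \<tau>: "0 < \<tau>" "\<tau> * (ln a - ln b) = a - b"
    using sbm_tau_bounds[OF ab] ab by (auto simp: \<tau>_def sbm_tau_def)
  have kk: "\<rho> * N \<le> k" "k \<le> \<rho> * N + 1" using K by (simp_all add: N_def k_def)
  have eps: "t * (\<epsilon> * L) \<le> (ln a - ln b) * \<epsilon> * L" if "t \<le> ln a - ln b" for t
    using mult_right_mono[OF that, of "\<epsilon> * L"] \<epsilon> L_nonneg by (simp add: mult_ac)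
  have sg: "\<sigma> i = 1 \<or> \<sigma> i = -1" using lab i by (simp add: labelings_def)
  then show ?thesis
  proof
    assume s: "\<sigma> i = 1"
    have "\<theta> * \<tau> \<le> (ln a - ln b) * \<tau>" using \<theta> \<tau> by (intro mult_right_mono) auto
    then have th: "\<theta> * \<tau> \<le> a" using \<tau>(2) ab by (simp add: mult.commute)
    define u where "u = a * (exp (- \<theta>) - 1)"
    define v where "v = b * (exp \<theta> - 1)"
    have u: "u \<le> 0" "- a \<le> u" using ab \<theta> by (auto simp: u_def mult_le_0_iff algebra_simps)
    have v: "0 \<le> v" using ab \<theta> by (simp add: v_def)
    have "(k - 1) * u \<le> (\<rho> * N - 1) * u" using kk u by (intro mult_right_mono_neg) auto
    moreover have "(N - k) * v \<le> (N - \<rho> * N) * v" using kk v by (intro mult_right_mono) auto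
    moreover have "\<theta> * \<tau> * (2 * k - N) \<le> \<theta> * \<tau> * (2 * (\<rho> * N + 1) - N)"
      using kk \<theta> \<tau> by (intro mult_left_mono) auto
    ultimately have "(k - 1) * u + (N - k) * v + \<theta> * \<tau> * (2 * k - N)
        \<le> (\<rho> * N - 1) * u + (N - \<rho> * N) * v + \<theta> * \<tau> * (2 * (\<rho> * N + 1) - N)" by linarith
    also have "\<dots> = N * (- \<tau> * (1 - 2 * \<rho>) * \<theta> + \<rho> * u + (1 - \<rho>) * v) - u + 2 * (\<theta> * \<tau>)"
      by (simp add: algebra_simps)
    also have "- \<tau> * (1 - 2 * \<rho>) * \<theta> + \<rho> * u + (1 - \<rho>) * v = - eta \<rho> a b"
      using F1 by (simp add: u_def v_def \<tau>_def mult_ac)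
    finally have "(k - 1) * u + (N - k) * v + \<theta> * \<tau> * (2 * k - N) \<le> - (N * eta \<rho> a b) + 5 * a"
      using u th ab by simp
    then have "l * ((k - 1) * u + (N - k) * v + \<theta> * \<tau> * (2 * k - N)) \<le> l * (- (N * eta \<rho> a b) + 5 * a)"
      using l by (intro mult_left_mono) auto
    also have "\<dots> = - (L * eta \<rho> a b) + l * (5 * a)" by (simp add: l(3)[symmetric] algebra_simps)
    also have "l * (5 * a) \<le> 5 * a" using l ab mult_right_mono[of l 1 "5 * a"] by simp
    finally have bound: "l * ((k - 1) * u + (N - k) * v + \<theta> * \<tau> * (2 * k - N)) + \<theta> * (\<epsilon> * L)
        \<le> 5 * a - (eta \<rho> a b - (ln a - ln b) * \<epsilon>) * L"
      using eps[of \<theta>] \<theta> by (simp add: algebra_simps)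
    have "Pr (\<lambda>A. (\<Sum>j<n. A i j * real_of_int (\<sigma> i * \<sigma> j)) - lam * (2 * real K - real n) * real_of_int (\<sigma> i) < \<epsilon> * L)
      \<le> exp ((N + (2 * k - N)) / 2 * (l * u) + (N - (2 * k - N)) / 2 * (l * v) - l * u + \<theta> * (\<epsilon> * L + l * (\<tau> * (2 * k - N))))"
      using degree_gap_tail[OF lab i \<theta>(1), where c = "l * (\<tau> * (2 * k - N))" and x = "\<epsilon> * L"] s
      by (simp add: lam_def \<tau>_def N_def k_def l_def u_def v_def mult_ac)
    also have "(N + (2 * k - N)) / 2 * (l * u) + (N - (2 * k - N)) / 2 * (l * v) - l * u + \<theta> * (\<epsilon> * L + l * (\<tau> * (2 * k - N)))
        = l * ((k - 1) * u + (N - k) * v + \<theta> * \<tau> * (2 * k - N)) + \<theta> * (\<epsilon> * L)"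
      by (simp add: field_simps)
    finally show ?thesis using bound by (smt (verit) exp_le_cancel_iff)
  next
    assume s: "\<sigma> i = -1"
    define u where "u = a * (exp (- \<theta>') - 1)"
    define v where "v = b * (exp \<theta>' - 1)"
    have u: "u \<le> 0" "- a \<le> u" using ab \<theta> by (auto simp: u_def mult_le_0_iff algebra_simps)
    have v: "0 \<le> v" using ab \<theta> by (simp add: v_def)
    have "exp \<theta>' \<le> exp (ln a - ln b)" using \<theta> by simp
    also have "\<dots> = a / b" using ab by (simp add: exp_diff)
    finally have va: "v \<le> a" using ab by (simp add: v_def field_simps)
    have "(N - k - 1) * u \<le> (N - (\<rho> * N + 1) - 1) * u" using kk u by (intro mult_right_mono_neg) auto
    moreover have "k * v \<le> (\<rho> * N + 1) * v" using kk v by (intro mult_right_mono) auto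
    moreover have "\<theta>' * \<tau> * (N - 2 * k) \<le> \<theta>' * \<tau> * (N - 2 * (\<rho> * N))"
      using kk \<theta> \<tau> by (intro mult_left_mono) auto
    ultimately have "(N - k - 1) * u + k * v + \<theta>' * \<tau> * (N - 2 * k)
        \<le> (N - (\<rho> * N + 1) - 1) * u + (\<rho> * N + 1) * v + \<theta>' * \<tau> * (N - 2 * (\<rho> * N))" by linarith
    also have "\<dots> = N * (\<tau> * (1 - 2 * \<rho>) * \<theta>' + (1 - \<rho>) * u + \<rho> * v) - 2 * u + v"
      by (simp add: algebra_simps)
    also have "\<tau> * (1 - 2 * \<rho>) * \<theta>' + (1 - \<rho>) * u + \<rho> * v = - eta \<rho> a b"
      using F2 by (simp add: u_def v_def \<tau>_def mult_ac)
    finally have "(N - k - 1) * u + k * v + \<theta>' * \<tau> * (N - 2 * k) \<le> - (N * eta \<rho> a b) + 5 * a"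
      using u va ab by simp
    then have "l * ((N - k - 1) * u + k * v + \<theta>' * \<tau> * (N - 2 * k)) \<le> l * (- (N * eta \<rho> a b) + 5 * a)"
      using l by (intro mult_left_mono) auto
    also have "\<dots> = - (L * eta \<rho> a b) + l * (5 * a)" by (simp add: l(3)[symmetric] algebra_simps)
    also have "l * (5 * a) \<le> 5 * a" using l ab mult_right_mono[of l 1 "5 * a"] by simp
    finally have bound: "l * ((N - k - 1) * u + k * v + \<theta>' * \<tau> * (N - 2 * k)) + \<theta>' * (\<epsilon> * L)
        \<le> 5 * a - (eta \<rho> a b - (ln a - ln b) * \<epsilon>) * L"
      using eps[of \<theta>'] \<theta> by (simp add: algebra_simps)
    have "Pr (\<lambda>A. (\<Sum>j<n. A i j * real_of_int (\<sigma> i * \<sigma> j)) - lam * (2 * real K - real n) * real_of_int (\<sigma> i) < \<epsilon> * L)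
      \<le> exp ((N - (2 * k - N)) / 2 * (l * u) + (N + (2 * k - N)) / 2 * (l * v) - l * u + \<theta>' * (\<epsilon> * L - l * (\<tau> * (2 * k - N))))"
      using degree_gap_tail[OF lab i \<theta>(2), where c = "l * (\<tau> * (2 * k - N))" and x = "\<epsilon> * L"] s
      by (simp add: lam_def \<tau>_def N_def k_def l_def u_def v_def mult_ac)
    also have "(N - (2 * k - N)) / 2 * (l * u) + (N + (2 * k - N)) / 2 * (l * v) - l * u + \<theta>' * (\<epsilon> * L - l * (\<tau> * (2 * k - N)))
        = l * ((N - k - 1) * u + k * v + \<theta>' * \<tau> * (N - 2 * k)) + \<theta>' * (\<epsilon> * L)"
      by (simp add: field_simps)
    finally show ?thesis using bound by (smt (verit) exp_le_cancel_iff)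
  qed
qed

end

section \<open>Exact recovery\<close>

context sbm
begin

text \<open>The deterministic theorem applies unless a diagonal entry is small, a degree is large,
  or the graph is irregular. The three terms bound these events.\<close>

lemma failure_prob:
  fixes \<rho> \<epsilon> \<delta> :: real and K k :: nat
  assumes lab: "\<sigma> \<in> labelings n K" and \<rho>: "0 < \<rho>" "\<rho> \<le> 1 / 2"
    and K: "\<rho> * real n \<le> real K" "real K \<le> \<rho> * real n + 1" and n4: "4 \<le> n"
    and \<epsilon>: "0 < \<epsilon>" and \<delta>: "0 < \<delta>"
    and \<beta>: "\<delta> * (2 * real k + 1) + 2 * (3 * a + 3) / 2 ^ k + a / real n \<le> \<beta>"
    and small_u: "\<beta> * (4 + 2 / \<rho>) < sbm_tau a b - b" and small_w: "10 * \<beta> < \<epsilon>"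
  shows "1 - Pr (\<lambda>A. sdp_unique_opt n K A (Ystar \<sigma>))
    \<le> real n * exp (5 * a - (eta \<rho> a b - (ln a - ln b) * \<epsilon>) * L) + real n * real n powr (-3)
      + Pr (irregular \<delta> ((\<delta> / (3 * a + 3))\<^sup>2))"
proof -
  define lam where "lam = sbm_tau a b * L / real n"
  define gap where "gap = (\<lambda>(A::nat \<Rightarrow> nat \<Rightarrow> real) (i::nat). (\<Sum>j<n. A i j * real_of_int (\<sigma> i * \<sigma> j)) - lam * (2 * real K - real n) * real_of_int (\<sigma> i))"
  define low where "low = (\<lambda>i A. gap A i < \<epsilon> * L)"
  define high where "high = (\<lambda>(i::nat) (A::nat \<Rightarrow> nat \<Rightarrow> real). (\<Sum>j<n. A i j) \<ge> (2 * a + 3) * L)"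
  define irr where "irr = irregular \<delta> ((\<delta> / (3 * a + 3))\<^sup>2)"
  have L: "L > 0" and n: "real n > 0" using n4 by auto
  have recover: "sdp_unique_opt n K (adj E) (Ystar \<sigma>)"
    if "\<not> (\<exists>i\<in>{..<n}. low i (adj E))" "\<not> (\<exists>i\<in>{..<n}. high i (adj E))" "\<not> irr (adj E)" for E
  proof (rule sdp_unique_opt_deterministic[OF lab, where p = "a * L / real n" and q = "b * L / real n"
        and lam = lam and \<kappa> = "\<rho> / 2" and \<beta> = "\<beta> * L" and \<epsilon> = "\<epsilon> * L"])
    show "adj E i j = adj E j i" for i j by (rule adj_sym)
    show "0 < \<rho> / 2" "\<rho> / 2 * real n \<le> real K" using \<rho> K n by (auto simp: field_simps)
    \<comment> \<open>For \<open>\<kappa> = \<rho> / 2\<close> the larger cluster needs a margin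
      against the rounding of \<open>K\<close>, supplied by \<open>n \<ge> 4\<close>.\<close>
    have "\<rho> * real n \<le> real n / 2" using \<rho> mult_right_mono[of \<rho> "1/2" "real n"] by simp
    moreover have "real n \<ge> 4" using n4 by simp
    ultimately have "\<rho> * real n / 2 \<le> real n - real K" using K by linarith
    then show "\<rho> / 2 * real n \<le> real n - real K" by simp
    show "\<epsilon> * L \<le> (\<Sum>j<n. adj E i j * real_of_int (\<sigma> i * \<sigma> j)) - lam * (2 * real K - real n) * real_of_int (\<sigma> i)" if "i < n" for i
      using \<open>\<not> (\<exists>i\<in>{..<n}. low i (adj E))\<close> that by (auto simp: low_def gap_def not_less)
    show "10 * (\<beta> * L) < \<epsilon> * L"
      using mult_strict_right_mono[OF small_w L] by (simp add: mult_ac)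
    have "real n * (lam - b * L / real n) = (sbm_tau a b - b) * L"
      using n by (simp add: lam_def field_simps)
    then show "\<beta> * L * (4 + 1 / (\<rho> / 2)) < real n * (lam - b * L / real n)"
      using mult_strict_right_mono[OF small_u L] by (simp add: mult_ac)
    have "0 \<le> \<delta> * (2 * real k + 1) + 2 * (3 * a + 3) / 2 ^ k + a / real n" using \<delta> ab by simp
    then have \<beta>0: "0 \<le> \<beta>" using \<beta> by linarith
    then show "0 \<le> \<beta> * L" using L by simp
    fix x y :: "nat \<Rightarrow> real"
    define Q where "Q = (\<Sum>i<n. (x i)\<^sup>2) + (\<Sum>i<n. (y i)\<^sup>2)"
    have Q0: "0 \<le> Q" unfolding Q_def by (intro add_nonneg_nonneg sum_nonneg) auto
    \<comment> \<open>The block mean has \<open>a * L / n\<close> on the diagonal where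
      \<open>dev\<close> subtracts nothing; this is the term \<open>a / n\<close> in the bound for
      \<beta>.\<close>
    have "(\<Sum>i<n. \<Sum>j<n. x i * (adj E i j - (if \<sigma> i = \<sigma> j then a * L / real n else b * L / real n)) * y j)
        = (\<Sum>i<n. \<Sum>j<n. x i * dev (adj E) i j * y j - (if i = j then a * L / real n * (x i * y i) else 0))"
      by (intro sum.cong refl) (auto simp: dev_def edge_prob_def algebra_simps)
    also have "\<dots> = (\<Sum>i<n. \<Sum>j<n. x i * dev (adj E) i j * y j) - a * L / real n * (\<Sum>i<n. x i * y i)"
      by (simp add: sum_subtractf sum_distrib_left)
    finally have eq: "(\<Sum>i<n. \<Sum>j<n. x i * (adj E i j - (if \<sigma> i = \<sigma> j then a * L / real n else b * L / real n)) * y j) = \<dots>" .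
    have xy: "\<bar>\<Sum>i<n. x i * y i\<bar> \<le> Q"
    proof -
      have "\<bar>\<Sum>i<n. x i * y i\<bar> \<le> (\<Sum>i<n. \<bar>x i * y i\<bar>)" by (rule sum_abs)
      also have "\<dots> \<le> (\<Sum>i<n. (x i)\<^sup>2 + (y i)\<^sup>2)"
      proof (rule sum_mono)
        fix i
        have "0 \<le> (\<bar>x i\<bar> - \<bar>y i\<bar>)\<^sup>2" by simp
        then have "2 * \<bar>x i * y i\<bar> \<le> (x i)\<^sup>2 + (y i)\<^sup>2" by (simp add: power2_diff abs_mult)
        then show "\<bar>x i * y i\<bar> \<le> (x i)\<^sup>2 + (y i)\<^sup>2" by linarith
      qed
      finally show ?thesis by (simp add: Q_def sum.distrib)
    qed
    have "\<bar>\<Sum>i<n. \<Sum>j<n. x i * dev (adj E) i j * y j\<bar> \<le> (\<delta> * (2 * real k + 1) + 2 * (3 * a + 3) / 2 ^ k) * L * Q"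
      unfolding Q_def using that \<delta> by (intro dev_bilinear_bound) (auto simp: irr_def high_def not_le intro: less_imp_le)
    moreover have "\<bar>a * L / real n * (\<Sum>i<n. x i * y i)\<bar> \<le> a / real n * L * Q"
      using ab L n xy by (simp add: abs_mult mult_left_mono divide_right_mono)
    ultimately have "\<bar>(\<Sum>i<n. \<Sum>j<n. x i * dev (adj E) i j * y j) - a * L / real n * (\<Sum>i<n. x i * y i)\<bar>
        \<le> (\<delta> * (2 * real k + 1) + 2 * (3 * a + 3) / 2 ^ k) * L * Q + a / real n * L * Q" by linarith
    also have "\<dots> = (\<delta> * (2 * real k + 1) + 2 * (3 * a + 3) / 2 ^ k + a / real n) * (L * Q)"
      by (simp only: distrib_right mult.assoc)
    also have "\<dots> \<le> \<beta> * (L * Q)"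
      using \<beta> L Q0 by (intro mult_right_mono) auto
    finally show "\<bar>\<Sum>i<n. \<Sum>j<n. x i * (adj E i j - (if \<sigma> i = \<sigma> j then a * L / real n else b * L / real n)) * y j\<bar>
        \<le> \<beta> * L * ((\<Sum>i<n. (x i)\<^sup>2) + (\<Sum>i<n. (y i)\<^sup>2))"
      unfolding eq Q_def by (simp add: mult.assoc)
  qed
  have "1 - Pr (\<lambda>A. sdp_unique_opt n K A (Ystar \<sigma>)) = Pr (\<lambda>A. \<not> sdp_unique_opt n K A (Ystar \<sigma>))"
    by (subst sbm_prob_compl) simp
  also have "\<dots> \<le> Pr (\<lambda>A. ((\<exists>i\<in>{..<n}. low i A) \<or> (\<exists>i\<in>{..<n}. high i A)) \<or> irr A)"
    by (rule Pr_mono) (use recover in blast)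
  also have "\<dots> \<le> (Pr (\<lambda>A. \<exists>i\<in>{..<n}. low i A) + Pr (\<lambda>A. \<exists>i\<in>{..<n}. high i A)) + Pr irr"
    by (intro order.trans[OF Pr_disj] add_mono Pr_disj order.refl)
  also have "\<dots> \<le> ((\<Sum>i<n. Pr (low i)) + (\<Sum>i<n. Pr (high i))) + Pr irr"
    by (intro add_mono Pr_union order.refl) auto
  also have "\<dots> \<le> ((\<Sum>i<n. exp (5 * a - (eta \<rho> a b - (ln a - ln b) * \<epsilon>) * L)) + (\<Sum>i<n. real n powr (-3))) + Pr irr"
  proof (intro add_mono sum_mono order.refl)
    fix i assume "i \<in> {..<n}"
    then have i: "i < n" by simp
    show "Pr (high i) \<le> real n powr (-3)" unfolding high_def by (rule degree_tail[OF i])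
    show "Pr (low i) \<le> exp (5 * a - (eta \<rho> a b - (ln a - ln b) * \<epsilon>) * L)"
      unfolding low_def gap_def lam_def using \<epsilon> by (intro degree_gap_prob[OF lab i \<rho> K]) auto
  qed
  finally show ?thesis by (simp add: irr_def)
qed

end

theorem theorem1:
  fixes a b \<rho> :: real
  assumes "a > b" and "b > 0"
    and "0 \<le> \<rho>" and "\<rho> \<le> 1/2"
    and "eta \<rho> a b > 1"
  shows "\<exists>c>0. \<forall>\<^sub>F n in sequentially.
           \<forall>\<sigma>\<in>labelings n (nat \<lceil>\<rho> * real n\<rceil>).
             sbm_prob n a b \<sigma> (\<lambda>A. sdp_unique_opt n (nat \<lceil>\<rho> * real n\<rceil>) A (Ystar \<sigma>))
               \<ge> 1 - real n powr (-c)"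
proof (cases "\<rho> = 0")
  case True
  \<comment> \<open>For \<rho> = 0 the ceiling is 0, so recovery is certain.\<close>
  have "sbm_prob n a b \<sigma> (\<lambda>A. sdp_unique_opt n 0 A (Ystar \<sigma>)) = 1" if "\<sigma> \<in> labelings n 0" for n \<sigma>
    using sdp_trivial_cluster[OF that] by (subst sbm_prob_compl) (simp add: sbm_prob_def)
  then show ?thesis using True by (intro exI[of _ 1]) auto
next
  case False
  then have \<rho>: "0 < \<rho>" "\<rho> \<le> 1 / 2" using assms by auto
  have ab: "0 < b" "b < a" using assms by auto
  define D where "D = ln a - ln b"
  have D: "D > 0" using ab by (simp add: D_def)
  \<comment> \<open>Half of the slack of \<open>eta\<close> above 1 pays for the threshold
    \<open>\<epsilon> * L\<close>. The exponent that remains is \<open>1 + g\<close>, enough for the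
    union bound.\<close>
  define g where "g = (eta \<rho> a b - 1) / 2"
  have g: "g > 0" using assms by (simp add: g_def)
  define \<epsilon> where "\<epsilon> = g / D"
  have \<epsilon>: "\<epsilon> > 0" using g D by (simp add: \<epsilon>_def)
  define \<beta> where "\<beta> = min ((sbm_tau a b - b) / (2 * (4 + 2 / \<rho>))) (\<epsilon> / 20)"
  have \<beta>: "\<beta> > 0" using sbm_tau_bounds[OF ab] \<rho> \<epsilon> by (auto simp: \<beta>_def intro!: divide_pos_pos add_pos_pos)
  have small_u: "\<beta> * (4 + 2 / \<rho>) < sbm_tau a b - b"
  proof -
    define F where "F = 4 + 2 / \<rho>"
    have F: "F > 0" using \<rho> by (simp add: F_def add_pos_pos)
    have "\<beta> * F \<le> (sbm_tau a b - b) / (2 * F) * F"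
      using F by (intro mult_right_mono) (auto simp: \<beta>_def F_def)
    also have "\<dots> < sbm_tau a b - b" using F sbm_tau_bounds[OF ab] by simp
    finally show ?thesis by (simp add: F_def)
  qed
  have small_w: "10 * \<beta> < \<epsilon>" 
  proof -
    have "\<beta> \<le> \<epsilon> / 20" unfolding \<beta>_def by (rule min.cobounded2)
    then show ?thesis using \<epsilon> by linarith
  qed
  \<comment> \<open>The norm budget \<beta> is split into thirds: first \<open>k\<close> makes the
    row sum term small, then \<delta> is adapted to the number of scales, and finally large
    \<open>n\<close> handles \<open>a / n\<close>.\<close>
  obtain k :: nat where k: "2 * (3 * a + 3) / 2 ^ k < \<beta> / 3"
  proof -
    obtain k where "6 * (3 * a + 3) / \<beta> < 2 ^ k" using real_arch_pow[of 2] by auto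
    then have "2 * (3 * a + 3) / 2 ^ k < \<beta> / 3" using \<beta> by (simp add: field_simps)
    then show ?thesis by (rule that)
  qed
  define \<delta> where "\<delta> = \<beta> / 3 / (2 * real k + 1)"
  have k1: "2 * real k + 1 > 0" by simp
  have \<delta>: "\<delta> > 0" using \<beta> k1 unfolding \<delta>_def by (intro divide_pos_pos) auto
  have \<delta>k: "\<delta> * (2 * real k + 1) = \<beta> / 3"
    unfolding \<delta>_def by (rule nonzero_eq_divide_eq[THEN iffD1]) (use k1 in auto)
  define \<delta>' where "\<delta>' = \<delta> * sqrt ((\<delta> / (3 * a + 3))\<^sup>2)"
  have \<delta>': "\<delta>' > 0" using \<delta> ab by (auto simp: \<delta>'_def)
  \<comment> \<open>The rate of \<open>irregular_prob\<close>; the extra factor \<open>ln n\<close>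
    in the exponent lets it outweigh \<open>4 ^ n\<close>.\<close>
  define c where "c = min (1 / 2) (\<delta>' / (4 * a)) * \<delta>' * (2 * exp (- (16 / \<delta>')) / a) / 2"
  have c: "c > 0" using \<delta>' ab by (auto simp: c_def)
  \<comment> \<open>All error terms are of order \<open>n powr (- 2 * g')\<close>; half of this
    exponent is spent on absorbing constants.\<close>
  define g' where "g' = min g 1 / 2"
  have g': "g' > 0" using g by (simp add: g'_def)
  \<comment> \<open>None of the conditions on \<open>n\<close> mentions the labeling, so the
    resulting bound is uniform over all labelings.\<close>
  have "eventually (\<lambda>n. a * ln (real n) / real n \<le> 1) sequentially"
  proof -
    have "(\<lambda>n. a * ln (real n) / real n) \<longlonglongrightarrow> 0" by real_asymp
    then have "eventually (\<lambda>n. a * ln (real n) / real n < 1) sequentially"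
      by (rule order_tendstoD(2)) simp
    then show ?thesis by (rule eventually_mono) simp
  qed
  moreover have "eventually (\<lambda>n. a / real n < \<beta> / 3) sequentially"
  proof -
    have "(\<lambda>n. a / real n) \<longlonglongrightarrow> 0" by real_asymp
    then show ?thesis using \<beta> by (intro order_tendstoD(2)) auto
  qed
  moreover have "eventually (\<lambda>n. 2 * 4 ^ n * exp (- (c * ln (real n) * real n)) \<le> 1 / real n) sequentially"
    using c by real_asymp
  \<comment> \<open>The constants come from the diagonal (\<open>exp (5 * a)\<close>), the degrees
    (1) and irregularity (18 + 1).\<close>
  moreover have "eventually (\<lambda>n. exp (5 * a) + 20 \<le> real n powr g') sequentially"
    using g' by real_asymp
  ultimately have "\<forall>\<^sub>F n in sequentially.
           \<forall>\<sigma>\<in>labelings n (nat \<lceil>\<rho> * real n\<rceil>).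
             sbm_prob n a b \<sigma> (\<lambda>A. sdp_unique_opt n (nat \<lceil>\<rho> * real n\<rceil>) A (Ystar \<sigma>))
               \<ge> 1 - real n powr (-g')"
    using eventually_ge_at_top[of 4]
  proof eventually_elim
    case (elim n)
    show ?case
    proof
      fix \<sigma> assume lab: "\<sigma> \<in> labelings n (nat \<lceil>\<rho> * real n\<rceil>)"
      define K where "K = nat \<lceil>\<rho> * real n\<rceil>"
      have "0 \<le> \<rho> * real n" using \<rho> by simp
      then have K: "\<rho> * real n \<le> real K" "real K \<le> \<rho> * real n + 1"
        unfolding K_def by linarith+
      interpret sbm n a b \<sigma>
        using ab elim by unfold_locales auto
      have n: "real n \<ge> 1" using elim by simp
      have "1 - Pr (\<lambda>A. sdp_unique_opt n K A (Ystar \<sigma>))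
        \<le> real n * exp (5 * a - (eta \<rho> a b - (ln a - ln b) * \<epsilon>) * L) + real n * real n powr (-3)
          + Pr (irregular \<delta> ((\<delta> / (3 * a + 3))\<^sup>2))"
      proof (rule failure_prob[OF _ \<rho> K _ \<epsilon> \<delta> _ small_u small_w])
        show "\<delta> * (2 * real k + 1) + 2 * (3 * a + 3) / 2 ^ k + a / real n \<le> \<beta>"
          using \<delta>k k elim by linarith
      qed (use lab elim in \<open>simp_all add: K_def\<close>)
      also have "real n * exp (5 * a - (eta \<rho> a b - (ln a - ln b) * \<epsilon>) * L) = exp (5 * a) * real n powr (- g)"
      proof -
        have "(ln a - ln b) * \<epsilon> = g" using D by (simp add: \<epsilon>_def D_def)
        moreover have "eta \<rho> a b = 2 * g + 1" by (simp add: g_def field_simps)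
        ultimately have "eta \<rho> a b - (ln a - ln b) * \<epsilon> = 1 + g" by linarith
        then have "5 * a - (eta \<rho> a b - (ln a - ln b) * \<epsilon>) * L = 5 * a + (- L + - g * L)"
          by (simp add: algebra_simps)
        then have "exp (5 * a - (eta \<rho> a b - (ln a - ln b) * \<epsilon>) * L) = exp (5 * a) * (exp (- L) * exp (- g * L))"
          by (simp only: exp_add)
        moreover have "exp (- L) = 1 / real n" using n by (simp add: exp_minus field_simps)
        ultimately show ?thesis using n by (simp add: powr_def)
      qed
      also have "real n * real n powr (-3) = real n powr (-2)"
        using n powr_mult_base[of "real n" "-3"] by simp
      also have "\<dots> \<le> real n powr (- 1)" using n by (intro powr_mono) auto
      also have "Pr (irregular \<delta> ((\<delta> / (3 * a + 3))\<^sup>2)) \<le> 19 * real n powr (- 1)"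
      proof -
        have "Pr (irregular \<delta> ((\<delta> / (3 * a + 3))\<^sup>2)) \<le> 18 / real n + 2 * 4 ^ n * exp (- (c * L * real n))"
          unfolding c_def \<delta>'_def using \<delta> ab by (intro irregular_prob) auto
        then show ?thesis using elim n by (simp add: powr_minus_divide)
      qed
      also have "exp (5 * a) * real n powr (- g) + real n powr (- 1) + 19 * real n powr (- 1)
          \<le> (exp (5 * a) + 20) * real n powr (- (2 * g'))"
      proof -
        have "real n powr (- g) \<le> real n powr (- (2 * g'))" "real n powr (- 1) \<le> real n powr (- (2 * g'))"
          using n by (intro powr_mono; simp add: g'_def)+
        then have "exp (5 * a) * real n powr (- g) \<le> exp (5 * a) * real n powr (- (2 * g'))"
          "20 * real n powr (- 1) \<le> 20 * real n powr (- (2 * g'))" by auto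
        then show ?thesis unfolding distrib_right by linarith
      qed
      also have "\<dots> \<le> real n powr g' * real n powr (- (2 * g'))"
        using elim by (intro mult_right_mono) auto
      also have "\<dots> = real n powr (- g')" by (simp add: powr_add[symmetric])
      finally show "1 - real n powr (- g') \<le> Pr (\<lambda>A. sdp_unique_opt n (nat \<lceil>\<rho> * real n\<rceil>) A (Ystar \<sigma>))"
        by (simp add: K_def)
    qed
  qed
  then show ?thesis using g' by blast
qed

end
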